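(* Let $n\geq 2$ be an integer, let $k$ be a field containing a primitive $n$-th root of unity $q$, and let $H_n(q)$ be the Taft algebra over $k$. Let $1\leq l,l'\leq n-1$ and $r,r'\in\mathbb{Z}_n$. Then $M(l,r)\otimes M(l',r')$ has a simple direct summand (as an $H_n(q)$-module) if and only if $l=l'$.
   Context: The Taft algebra $H_n(q)$ is the $k$-algebra generated by $g,h$ subject to $g^n=1$, $h^n=0$, $hg=qgh$. It is a Hopf algebra with comultiplication $\Delta(g)=g\otimes g$, $\Delta(h)=1\otimes h+h\otimes g$, counit $\varepsilon(g)=1$, $\varepsilon(h)=0$, and antipode $S(g)=g^{-1}$, $S(h)=-q^{-1}g^{n-1}h$. All modules are finite-dimensional left modules, and $M\otimes N=M\otimes_k N$ is a module via $\Delta$. Write $\mathbb{Z}_n=\mathbb{Z}/(n)$. For $1\leq l\leq n$ and $r\in\mathbb{Z}_n$ (represented by an integer; the choice of representative does not matter since $q^n=1$), $M(l,r)$ is the $l$-dimensional $H_n(q)$-module with $k$-basis $v_1,\dots,v_l$ and action $g\cdot v_j=q^{r-j+1}v_j$ for $1\leq j\leq l$, $h\cdot v_j=v_{j+1}$ for $1\leq j\leq l-1$, and $h\cdot v_l=0$. *)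

theory Defs
  imports
    Complex_Main
    "HOL-Algebra.QuotRing"
    "HOL-Algebra.Module"
    "HOL-Library.Poly_Mapping"
    "HOL-Library.Product_Plus"
begin

section \<open>Free vector spaces\<close>

text \<open>The type \<open>'b \<Rightarrow>\<^sub>0 'k\<close> serves as the \<open>'k\<close>-vector space with basis \<open>'b\<close>; the basis vector
  belonging to \<open>b\<close> is \<open>Poly_Mapping.single b 1\<close>.\<close>

definition pm_scale :: "'k::field \<Rightarrow> ('b \<Rightarrow>\<^sub>0 'k) \<Rightarrow> ('b \<Rightarrow>\<^sub>0 'k)"
  where "pm_scale c v = Poly_Mapping.map ((*) c) v"

lemma lookup_pm_scale [simp]:
  "Poly_Mapping.lookup (pm_scale c v) b = c * Poly_Mapping.lookup v b"
  by (simp add: pm_scale_def map.rep_eq when_def)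

interpretation pm: vector_space pm_scale
  by unfold_locales
    (auto intro!: poly_mapping_eqI simp: lookup_add algebra_simps)

definition lin_ext :: "('b \<Rightarrow> ('c \<Rightarrow>\<^sub>0 'k)) \<Rightarrow> ('b \<Rightarrow>\<^sub>0 'k::field) \<Rightarrow> ('c \<Rightarrow>\<^sub>0 'k)"
  where "lin_ext f v = (\<Sum>b\<in>Poly_Mapping.keys v. pm_scale (Poly_Mapping.lookup v b) (f b))"


section \<open>The Taft algebra\<close>

datatype taft_gen = Gen_g | Gen_h

text \<open>Words are wrapped in a type of their own, so that concatenation can be its (noncommutative)
  addition. The convolution product of \<open>Poly_Mapping\<close> then turns \<open>taft_word \<Rightarrow>\<^sub>0 'k\<close> into the free
  associative algebra on the two generators, and \<open>taft_word \<times> taft_word \<Rightarrow>\<^sub>0 'k\<close> into its tensor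
  square, \<open>Poly_Mapping.single (u, v) 1\<close> being the element $u \otimes v$.\<close>

datatype taft_word = Word "taft_gen list"

instantiation taft_word :: monoid_add
begin

definition zero_taft_word :: taft_word
  where "0 = Word []"

fun plus_taft_word :: "taft_word \<Rightarrow> taft_word \<Rightarrow> taft_word"
  where "Word xs + Word ys = Word (xs @ ys)"

instance
proof
  fix a b c :: taft_word
  show "a + b + c = a + (b + c)" by (cases a; cases b; cases c) simp
  show "0 + a = a" by (cases a) (simp add: zero_taft_word_def)
  show "a + 0 = a" by (cases a) (simp add: zero_taft_word_def)
qed

end

type_synonym 'k free_elt = "taft_word \<Rightarrow>\<^sub>0 'k"

definition free_gen :: "taft_gen \<Rightarrow> 'k::field free_elt"
  where "free_gen x = Poly_Mapping.single (Word [x]) 1"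

definition free_const :: "'k::field \<Rightarrow> 'k free_elt"
  where "free_const c = Poly_Mapping.single 0 c"

definition free_algebra :: "'k::field free_elt ring"
  where "free_algebra =
    \<lparr>carrier = UNIV, mult = (*), one = 1, zero = 0, add = (+)\<rparr>"

definition taft_ideal :: "nat \<Rightarrow> 'k::field \<Rightarrow> 'k free_elt set"
  where "taft_ideal n q = genideal free_algebra
    {free_gen Gen_g ^ n - 1,
     free_gen Gen_h ^ n,
     free_gen Gen_h * free_gen Gen_g - free_const q * free_gen Gen_g * free_gen Gen_h}"

definition taft_algebra :: "nat \<Rightarrow> 'k::field \<Rightarrow> 'k free_elt set ring"
  where "taft_algebra n q = free_algebra Quot taft_ideal n q"

definition taft_class :: "nat \<Rightarrow> 'k::field \<Rightarrow> 'k free_elt \<Rightarrow> 'k free_elt set"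
  where "taft_class n q p = taft_ideal n q +>\<^bsub>free_algebra\<^esub> p"

lemma ring_free_algebra: "ring (free_algebra :: 'k::field free_elt ring)"
proof (rule ringI)
  show "abelian_group (free_algebra :: 'k free_elt ring)"
    by (rule abelian_groupI)
      (auto simp: free_algebra_def add.assoc add.commute
        intro: exI[where x = "- x" for x] left_minus)
  show "monoid (free_algebra :: 'k free_elt ring)"
    by (rule monoidI) (auto simp: free_algebra_def mult.assoc)
qed (auto simp: free_algebra_def algebra_simps)

lemma ideal_taft_ideal: "ideal (taft_ideal n q) free_algebra"
  unfolding taft_ideal_def
  by (rule ring.genideal_ideal[OF ring_free_algebra]) (simp add: free_algebra_def)

lemma ring_taft_algebra: "ring (taft_algebra n q)"
  unfolding taft_algebra_def by (rule ideal.quotient_is_ring[OF ideal_taft_ideal])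

text \<open>The comultiplication, on the level of the free algebra: the algebra homomorphism with
  $\Delta(g) = g \otimes g$ and $\Delta(h) = 1 \otimes h + h \otimes g$. The comultiplication of the
  Taft algebra is the map induced by it on the quotient.\<close>

fun comult_gen :: "taft_gen \<Rightarrow> (taft_word \<times> taft_word \<Rightarrow>\<^sub>0 'k::field)"
  where
    "comult_gen Gen_g = Poly_Mapping.single (Word [Gen_g], Word [Gen_g]) 1"
  | "comult_gen Gen_h = Poly_Mapping.single (Word [], Word [Gen_h]) 1
      + Poly_Mapping.single (Word [Gen_h], Word [Gen_g]) 1"

fun comult_word :: "taft_word \<Rightarrow> (taft_word \<times> taft_word \<Rightarrow>\<^sub>0 'k::field)"
  where "comult_word (Word xs) = prod_list (map comult_gen xs)"

definition comult :: "'k::field free_elt \<Rightarrow> (taft_word \<times> taft_word \<Rightarrow>\<^sub>0 'k)"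
  where "comult = lin_ext comult_word"


section \<open>Left modules over a noncommutative ring\<close>

text \<open>The locale \<open>module\<close> of \<open>HOL-Algebra\<close> requires a commutative ring of scalars; its record type
  and the locale \<open>submodule\<close> do not, and are used here for left modules.\<close>

locale left_module = R?: ring R + M?: abelian_group M
  for R (structure) and M :: "('a, 'b, 'd) module_scheme" (structure) +
  assumes smult_closed:
      "\<lbrakk>a \<in> carrier R; x \<in> carrier M\<rbrakk> \<Longrightarrow> a \<odot>\<^bsub>M\<^esub> x \<in> carrier M"
    and smult_l_distr:
      "\<lbrakk>a \<in> carrier R; b \<in> carrier R; x \<in> carrier M\<rbrakk>
        \<Longrightarrow> (a \<oplus>\<^bsub>R\<^esub> b) \<odot>\<^bsub>M\<^esub> x = a \<odot>\<^bsub>M\<^esub> x \<oplus>\<^bsub>M\<^esub> b \<odot>\<^bsub>M\<^esub> x"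
    and smult_r_distr:
      "\<lbrakk>a \<in> carrier R; x \<in> carrier M; y \<in> carrier M\<rbrakk>
        \<Longrightarrow> a \<odot>\<^bsub>M\<^esub> (x \<oplus>\<^bsub>M\<^esub> y) = a \<odot>\<^bsub>M\<^esub> x \<oplus>\<^bsub>M\<^esub> a \<odot>\<^bsub>M\<^esub> y"
    and smult_assoc:
      "\<lbrakk>a \<in> carrier R; b \<in> carrier R; x \<in> carrier M\<rbrakk>
        \<Longrightarrow> (a \<otimes>\<^bsub>R\<^esub> b) \<odot>\<^bsub>M\<^esub> x = a \<odot>\<^bsub>M\<^esub> (b \<odot>\<^bsub>M\<^esub> x)"
    and smult_one: "x \<in> carrier M \<Longrightarrow> \<one>\<^bsub>R\<^esub> \<odot>\<^bsub>M\<^esub> x = x"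

definition simple_module :: "('a, 'c) ring_scheme \<Rightarrow> ('a, 'b, 'd) module_scheme \<Rightarrow> bool"
  where "simple_module R M \<longleftrightarrow>
    left_module R M \<and> carrier M \<noteq> {\<zero>\<^bsub>M\<^esub>} \<and>
    (\<forall>N. submodule N R M \<longrightarrow> N = {\<zero>\<^bsub>M\<^esub>} \<or> N = carrier M)"

definition direct_summand :: "('a, 'c) ring_scheme \<Rightarrow> ('a, 'b, 'd) module_scheme \<Rightarrow> 'b set \<Rightarrow> bool"
  where "direct_summand R M W \<longleftrightarrow>
    submodule W R M \<and>
    (\<exists>U. submodule U R M \<and> W \<inter> U = {\<zero>\<^bsub>M\<^esub>} \<and> W <+>\<^bsub>M\<^esub> U = carrier M)"

definition has_simple_direct_summand ::
    "('a, 'c) ring_scheme \<Rightarrow> ('a, 'b, 'd) module_scheme \<Rightarrow> bool"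
  where "has_simple_direct_summand R M \<longleftrightarrow>
    (\<exists>W. direct_summand R M W \<and> simple_module R (M\<lparr>carrier := W\<rparr>))"


section \<open>The modules \<open>M(l, r)\<close>\<close>

text \<open>The fields \<open>mult\<close> and \<open>one\<close>, which the record type \<open>module\<close> inherits from \<open>ring\<close>, play no role
  for modules.\<close>

fun word_action ::
    "(('b \<Rightarrow>\<^sub>0 'k::field) \<Rightarrow> ('b \<Rightarrow>\<^sub>0 'k)) \<Rightarrow> (('b \<Rightarrow>\<^sub>0 'k) \<Rightarrow> ('b \<Rightarrow>\<^sub>0 'k)) \<Rightarrow>
      taft_word \<Rightarrow> ('b \<Rightarrow>\<^sub>0 'k) \<Rightarrow> ('b \<Rightarrow>\<^sub>0 'k)"
  where "word_action G H (Word xs) v =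
    foldr (\<lambda>x. case x of Gen_g \<Rightarrow> G | Gen_h \<Rightarrow> H) xs v"

definition taft_M_g :: "'k::field \<Rightarrow> int \<Rightarrow> (nat \<Rightarrow>\<^sub>0 'k) \<Rightarrow> (nat \<Rightarrow>\<^sub>0 'k)"
  where "taft_M_g q r = lin_ext (\<lambda>j. Poly_Mapping.single j (q powi (r - int j + 1)))"

definition taft_M_h :: "nat \<Rightarrow> (nat \<Rightarrow>\<^sub>0 'k::field) \<Rightarrow> (nat \<Rightarrow>\<^sub>0 'k)"
  where "taft_M_h l = lin_ext (\<lambda>j. if j < l then Poly_Mapping.single (j + 1) 1 else 0)"

text \<open>An element of the Taft algebra is a coset of \<open>taft_ideal n q\<close>; it acts through any of its
  representatives in the free algebra. Since \<open>taft_ideal n q\<close> acts as zero on the carrier when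
  \<open>q\<close> is a primitive \<open>n\<close>-th root of unity and $l \le n$, the choice is immaterial.\<close>

definition taft_M ::
    "nat \<Rightarrow> 'k::field \<Rightarrow> nat \<Rightarrow> int \<Rightarrow> ('k free_elt set, nat \<Rightarrow>\<^sub>0 'k) module"
  where "taft_M n q l r =
    \<lparr>carrier = {v. Poly_Mapping.keys v \<subseteq> {1..l}},
     mult = undefined, one = undefined, zero = 0, add = (+),
     smult = (\<lambda>X v.
       lin_ext (\<lambda>w. word_action (taft_M_g q r) (taft_M_h l) w v) (SOME p. p \<in> X))\<rparr>"


section \<open>Tensor products of modules over the Taft algebra\<close>

definition base_smult ::
    "nat \<Rightarrow> 'k::field \<Rightarrow> ('k free_elt set, 'm, 'd) module_scheme \<Rightarrow> 'k \<Rightarrow> 'm \<Rightarrow> 'm"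
  where "base_smult n q M c x = taft_class n q (free_const c) \<odot>\<^bsub>M\<^esub> x"

text \<open>$M \otimes_k N$ is the quotient of the vector space with basis $M \times N$ by the subspace
  spanned by the bilinearity relations.\<close>

definition tensor_free ::
    "('k free_elt set, 'm, 'd) module_scheme \<Rightarrow> ('k free_elt set, 'm', 'e) module_scheme \<Rightarrow>
      ('m \<times> 'm' \<Rightarrow>\<^sub>0 'k::field) ring"
  where "tensor_free M N =
    \<lparr>carrier = {s. Poly_Mapping.keys s \<subseteq> carrier M \<times> carrier N},
     mult = undefined, one = undefined, zero = 0, add = (+)\<rparr>"

definition tensor_pair :: "'m \<Rightarrow> 'm' \<Rightarrow> ('m \<times> 'm' \<Rightarrow>\<^sub>0 'k::field)"
  where "tensor_pair x y = Poly_Mapping.single (x, y) 1"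

definition tensor_relations ::
    "nat \<Rightarrow> 'k::field \<Rightarrow> ('k free_elt set, 'm, 'd) module_scheme \<Rightarrow>
      ('k free_elt set, 'm', 'e) module_scheme \<Rightarrow> ('m \<times> 'm' \<Rightarrow>\<^sub>0 'k) set"
  where "tensor_relations n q M N = pm.span
    ({tensor_pair (x \<oplus>\<^bsub>M\<^esub> x') y - tensor_pair x y - tensor_pair x' y | x x' y.
        x \<in> carrier M \<and> x' \<in> carrier M \<and> y \<in> carrier N} \<union>
     {tensor_pair x (y \<oplus>\<^bsub>N\<^esub> y') - tensor_pair x y - tensor_pair x y' | x y y'.
        x \<in> carrier M \<and> y \<in> carrier N \<and> y' \<in> carrier N} \<union>
     {tensor_pair (base_smult n q M c x) y - pm_scale c (tensor_pair x y) | c x y.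
        x \<in> carrier M \<and> y \<in> carrier N} \<union>
     {tensor_pair x (base_smult n q N c y) - pm_scale c (tensor_pair x y) | c x y.
        x \<in> carrier M \<and> y \<in> carrier N})"

text \<open>The action of $\sum_i u_i \otimes v_i$ on the vector space with basis $M \times N$, sending
  the basis vector belonging to $(x, y)$ to the sum of those belonging to $(u_i x, v_i y)$.\<close>

definition tensor_action ::
    "nat \<Rightarrow> 'k::field \<Rightarrow> ('k free_elt set, 'm, 'd) module_scheme \<Rightarrow>
      ('k free_elt set, 'm', 'e) module_scheme \<Rightarrow>
      (taft_word \<times> taft_word \<Rightarrow>\<^sub>0 'k) \<Rightarrow> ('m \<times> 'm' \<Rightarrow>\<^sub>0 'k) \<Rightarrow> ('m \<times> 'm' \<Rightarrow>\<^sub>0 'k)"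
  where "tensor_action n q M N d s =
    lin_ext (\<lambda>(u, v). lin_ext (\<lambda>(x, y).
      tensor_pair (taft_class n q (Poly_Mapping.single u 1) \<odot>\<^bsub>M\<^esub> x)
                  (taft_class n q (Poly_Mapping.single v 1) \<odot>\<^bsub>N\<^esub> y)) s) d"

text \<open>As for \<open>taft_M\<close>, the result does not depend on the chosen representatives, provided that
  \<open>M\<close> and \<open>N\<close> are left modules over the Taft algebra and \<open>q\<close> is a primitive \<open>n\<close>-th root of unity.\<close>

definition taft_tensor ::
    "nat \<Rightarrow> 'k::field \<Rightarrow> ('k free_elt set, 'm, 'd) module_scheme \<Rightarrow>
      ('k free_elt set, 'm', 'e) module_scheme \<Rightarrow>
      ('k free_elt set, ('m \<times> 'm' \<Rightarrow>\<^sub>0 'k) set) module"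
  where "taft_tensor n q M N =
    \<lparr>carrier = a_rcosets\<^bsub>tensor_free M N\<^esub> (tensor_relations n q M N),
     mult = undefined, one = undefined,
     zero = tensor_relations n q M N, add = set_add (tensor_free M N),
     smult = (\<lambda>X t. tensor_relations n q M N +>\<^bsub>tensor_free M N\<^esub>
       tensor_action n q M N (comult (SOME p. p \<in> X)) (SOME s. s \<in> t))\<rparr>"


definition primitive_root_of_unity :: "nat \<Rightarrow> 'k::field \<Rightarrow> bool"
  where "primitive_root_of_unity n q \<longleftrightarrow> q ^ n = 1 \<and> (\<forall>m. 0 < m \<and> m < n \<longrightarrow> q ^ m \<noteq> 1)"

end

theory Submission
  imports Defs
begin

text \<open>Write \<open>T\<close> for the tensor product $M(l,r) \otimes M(l',r')$, with its
  basis $v_i \otimes v_j$. On it $h$ acts by $h(v_i \otimes v_j) = v_i \otimes v_{j+1} +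
  q^{r'-j+1} v_{i+1} \otimes v_j$, where vectors with an index out of range are read as zero, and
  $g$ acts on the antidiagonal $i + j = s$ by the scalar $q^{r+r'+2-s}$.

  Everything is decided by the kernel and the image of $h$ on \<open>T\<close>. As $h$ is
  nilpotent and $hg = qgh$, the kernel of $h$ in a simple submodule \<open>W\<close> is a nonzero
  submodule, so $h$ kills \<open>W\<close>. If moreover $T = W \oplus U$, then $hT = hU \subseteq
  U$, so \<open>W\<close> lies in $\ker h$ and meets $hT$ trivially. Hence there is no simple
  summand if $\ker h \subseteq hT$ (\<open>no_simple_direct_summand\<close>). In the other
  direction, let $w \in \ker h$ be an eigenvector of $g$ and \<open>\<phi>\<close> a linear form
  that vanishes on $hT$ but not at $w$ and is an eigenvector of the transpose of $g$. Then
  $\ker \phi$ is a submodule complementary to the line through $w$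
  (\<open>has_simple_direct_summandI\<close>).

  If $l \neq l'$, then $\ker h \subseteq hT$ (\<open>tensor_h_exact\<close>). The map $h$ takes
  one antidiagonal to the next and is bidiagonal there, so that both $hx = 0$ and $hy = x$ can be
  solved by recursion on one coordinate. The first recursion shows that an element of the kernel
  is concentrated on the antidiagonals $i + j > \max(l,l')$. For $l < l'$, the equations of the
  second recursion that are not used up to define $y$ are those at the places $(i,1)$, and these
  lie outside that region because $i + 1 \leq l'$. For $l > l'$ the coordinates exchange their
  roles.

  If $l = l'$, the antidiagonal $i + j = l + 1$ carries a vector $w = \sum_i c_i\, v_i \otimes
  v_{l+1-i}$ in $\ker h$ with all $c_i \neq 0$, and the linear form with weights $q^{-i}/c_i$ on
  the same antidiagonal vanishes on $hT$. Its value at $w$ is $q^{-1} + \dots + q^{-l}$, which is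
  nonzero because $q^l \neq 1$ for $0 < l < n$.

  It remains to connect this computation with the tensor product, which is a quotient of formal
  combinations of pairs, acted upon through representatives of cosets. The module is isomorphic to
  the space with basis $v_i \otimes v_j$ (\<open>taft_tensor_iso\<close>), and simple direct
  summands can be transported along isomorphisms. The representatives are immaterial because the
  two operators on \<open>T\<close> satisfy the relations of the Taft algebra; for $h^n = 0$ this
  rests on the quantum binomial theorem, whose inner coefficients vanish at a primitive $n$-th
  root of unity (\<open>skew_sum_nilpotent\<close>).\<close>


section \<open>Linear maps between free vector spaces\<close>

interpretation pm_pair: vector_space_pair pm_scale pm_scale
  by unfold_locales

abbreviation pm_linear :: "(('b \<Rightarrow>\<^sub>0 'k::field) \<Rightarrow> ('c \<Rightarrow>\<^sub>0 'k)) \<Rightarrow> bool"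
  where "pm_linear \<equiv> Vector_Spaces.linear pm_scale pm_scale"

abbreviation pm_unit :: "'b \<Rightarrow> ('b \<Rightarrow>\<^sub>0 'k::field)"
  where "pm_unit b \<equiv> Poly_Mapping.single b 1"

definition coord_space :: "'b set \<Rightarrow> ('b \<Rightarrow>\<^sub>0 'k::field) set"
  where "coord_space S = {v. Poly_Mapping.keys v \<subseteq> S}"

lemma pm_linearI:
  assumes "\<And>x y. f (x + y) = f x + f y" "\<And>c x. f (pm_scale c x) = pm_scale c (f x)"
  shows "pm_linear f"
  using assms by unfold_locales auto

lemma pm_linear_id: "pm_linear (\<lambda>x. x)"
  by (rule pm_linearI) auto

lemma pm_linear_comp: "pm_linear f \<Longrightarrow> pm_linear g \<Longrightarrow> pm_linear (\<lambda>x. f (g x))"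
  by (rule pm_linearI) (simp_all add: pm_pair.linear_add pm_pair.linear_scale)

lemma pm_linear_funpow: "pm_linear f \<Longrightarrow> pm_linear (f ^^ m)"
  for f :: "('b \<Rightarrow>\<^sub>0 'k::field) \<Rightarrow> ('b \<Rightarrow>\<^sub>0 'k)"
proof (induction m)
  case 0
  show ?case by (rule pm_linearI) auto
next
  case (Suc m)
  then show ?case using pm_linear_comp[of f "f ^^ m"] by (simp add: o_def)
qed

lemma poly_mapping_sum_monomials:
  "(\<Sum>a\<in>Poly_Mapping.keys p. Poly_Mapping.single a (Poly_Mapping.lookup p a)) = p"
proof (rule poly_mapping_eqI)
  fix b
  show "Poly_Mapping.lookup
      (\<Sum>a\<in>Poly_Mapping.keys p. Poly_Mapping.single a (Poly_Mapping.lookup p a)) b =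
      Poly_Mapping.lookup p b"
    by (cases "b \<in> Poly_Mapping.keys p")
      (simp_all add: lookup_sum lookup_single when_def sum.delta in_keys_iff)
qed

lemma pm_scale_single [simp]: "pm_scale c (Poly_Mapping.single b d) = Poly_Mapping.single b (c * d)"
  by (rule poly_mapping_eqI) (simp add: lookup_single when_def)

lemma keys_pm_scale: "Poly_Mapping.keys (pm_scale c v) \<subseteq> Poly_Mapping.keys v"
  by (auto simp: in_keys_iff)

lemma lookup_zero_outside_coord_space:
  "v \<in> coord_space S \<Longrightarrow> b \<notin> S \<Longrightarrow> Poly_Mapping.lookup v b = 0"
  by (auto simp: coord_space_def in_keys_iff)

lemma pm_unit_in_coord_space [simp]: "b \<in> S \<Longrightarrow> pm_unit b \<in> coord_space S"
  by (simp add: coord_space_def)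

lemma subspace_coord_space: "pm.subspace (coord_space S :: ('b \<Rightarrow>\<^sub>0 'k::field) set)"
proof (rule pm.subspaceI)
  fix x y :: "'b \<Rightarrow>\<^sub>0 'k" and c
  assume "x \<in> coord_space S"
  then show "pm_scale c x \<in> coord_space S"
    using keys_pm_scale[of c x] by (auto simp: coord_space_def)
  assume "y \<in> coord_space S"
  with \<open>x \<in> coord_space S\<close> show "x + y \<in> coord_space S"
    using Poly_Mapping.keys_add[of x y] by (auto simp: coord_space_def)
qed (simp add: coord_space_def)

lemma lin_ext_superset:
  assumes "finite A" "Poly_Mapping.keys v \<subseteq> A"
  shows "lin_ext f v = (\<Sum>b\<in>A. pm_scale (Poly_Mapping.lookup v b) (f b))"
  unfolding lin_ext_def using assms
  by (intro sum.mono_neutral_left) (auto simp: in_keys_iff)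

lemma pm_linear_lin_ext: "pm_linear (lin_ext f)"
  for f :: "'b \<Rightarrow> ('c \<Rightarrow>\<^sub>0 'k::field)"
proof (rule pm_linearI)
  fix x y :: "'b \<Rightarrow>\<^sub>0 'k" and c
  let ?A = "Poly_Mapping.keys x \<union> Poly_Mapping.keys y"
  show "lin_ext f (x + y) = lin_ext f x + lin_ext f y"
    using Poly_Mapping.keys_add[of x y]
    by (simp add: lin_ext_superset[of ?A] lookup_add pm.scale_left_distrib sum.distrib)
  show "lin_ext f (pm_scale c x) = pm_scale c (lin_ext f x)"
    using keys_pm_scale[of c x]
    by (simp add: lin_ext_superset[of "Poly_Mapping.keys x"] pm.scale_sum_right)
qed

lemma lin_ext_single [simp]: "lin_ext f (Poly_Mapping.single b c) = pm_scale c (f b)"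
  by (cases "c = 0") (auto simp: lin_ext_def)

lemmas lin_ext_add = pm_pair.linear_add[OF pm_linear_lin_ext]
lemmas lin_ext_diff = pm_pair.linear_diff[OF pm_linear_lin_ext]
lemmas lin_ext_sum = pm_pair.linear_sum[OF pm_linear_lin_ext]
lemmas lin_ext_zero = pm_pair.linear_0[OF pm_linear_lin_ext]

lemma lin_ext_unit: "lin_ext pm_unit v = v"
  using poly_mapping_sum_monomials[of v] by (simp add: lin_ext_def)

lemma pm_linear_on_lin_ext: "pm_linear L \<Longrightarrow> L (lin_ext f v) = lin_ext (\<lambda>b. L (f b)) v"
  by (simp add: lin_ext_def pm_pair.linear_sum pm_pair.linear_scale)

lemma pm_linear_eq_lin_ext: "pm_linear L \<Longrightarrow> L v = lin_ext (\<lambda>b. L (pm_unit b)) v"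
  using pm_linear_on_lin_ext[of L pm_unit v] by (simp add: lin_ext_unit)

lemma pm_linear_eqI:
  assumes "pm_linear L" "pm_linear L'" "\<And>b. L (pm_unit b) = L' (pm_unit b)"
  shows "L v = L' v"
  using assms pm_linear_eq_lin_ext[of L v] pm_linear_eq_lin_ext[of L' v] by simp

lemma lin_ext_in_subspace:
  assumes "pm.subspace K" "\<And>b. b \<in> Poly_Mapping.keys v \<Longrightarrow> f b \<in> K"
  shows "lin_ext f v \<in> K"
  unfolding lin_ext_def
  by (intro pm.subspace_sum assms pm.subspace_scale)

lemma lin_ext_pointwise_diff: "lin_ext (\<lambda>b. f b - g b) v = lin_ext f v - lin_ext g v"
  by (simp add: lin_ext_def pm.scale_right_diff_distrib sum_subtractf)

lemma pm_linear_lin_ext_pointwise: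
  assumes "\<And>b. pm_linear (f b)"
  shows "pm_linear (\<lambda>v. lin_ext (\<lambda>b. f b v) p)"
proof (rule pm_linearI)
  fix x y c
  show "lin_ext (\<lambda>b. f b (x + y)) p = lin_ext (\<lambda>b. f b x) p + lin_ext (\<lambda>b. f b y) p"
    by (simp add: lin_ext_def pm_pair.linear_add[OF assms] pm.scale_right_distrib sum.distrib)
  show "lin_ext (\<lambda>b. f b (pm_scale c x)) p = pm_scale c (lin_ext (\<lambda>b. f b x) p)"
    by (simp add: lin_ext_def pm_pair.linear_scale[OF assms] pm.scale_sum_right mult.commute)
qed

lemma pm_linear_preserves_coord_space:
  assumes "pm_linear L" "\<And>b. b \<in> S \<Longrightarrow> L (pm_unit b) \<in> coord_space S'" "v \<in> coord_space S"
  shows "L v \<in> coord_space S'"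
  unfolding pm_linear_eq_lin_ext[OF assms(1), of v] using assms
  by (intro lin_ext_in_subspace subspace_coord_space) (auto simp: coord_space_def)

text \<open>A map that is linear only up to a subspace \<open>K\<close> agrees up to
  \<open>K\<close> with the linear extension of its values on basis vectors. This is what makes
  $b \otimes b'$ span a tensor product.\<close>

lemma linear_modulo_subspace:
  fixes f :: "('b \<Rightarrow>\<^sub>0 'k::field) \<Rightarrow> ('c \<Rightarrow>\<^sub>0 'k)"
  assumes K: "pm.subspace K"
    and add: "\<And>x y. x \<in> coord_space S \<Longrightarrow> y \<in> coord_space S \<Longrightarrow> f (x + y) - f x - f y \<in> K"
    and scale: "\<And>c x. x \<in> coord_space S \<Longrightarrow> f (pm_scale c x) - pm_scale c (f x) \<in> K"
    and v: "v \<in> coord_space S"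
  shows "f v - lin_ext (\<lambda>b. f (pm_unit b)) v \<in> K"
proof -
  define g where "g x = f x - lin_ext (\<lambda>b. f (pm_unit b)) x" for x
  have g_add: "g (x + y) \<in> K" if "x \<in> coord_space S" "y \<in> coord_space S" "g x \<in> K" "g y \<in> K" for x y
  proof -
    have "g (x + y) = (f (x + y) - f x - f y) + g x + g y" by (simp add: g_def lin_ext_add)
    then show ?thesis using add that by (simp add: pm.subspace_add[OF K])
  qed
  have g_zero: "g 0 \<in> K"
    using scale[OF pm.subspace_0[OF subspace_coord_space], of 0] by (simp add: g_def lin_ext_zero)
  have g_single: "g (Poly_Mapping.single b c) \<in> K" if "b \<in> S" for b c
    using scale[OF pm_unit_in_coord_space[OF that], of c] by (simp add: g_def)
  have "g (\<Sum>b\<in>A. Poly_Mapping.single b (Poly_Mapping.lookup v b)) \<in> K"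
    if "finite A" "A \<subseteq> S" for A
    using that
  proof (induction A rule: finite_induct)
    case (insert b A)
    have "Poly_Mapping.single a c \<in> coord_space S" if "a \<in> S" for a and c :: 'k
      using that by (simp add: coord_space_def)
    then show ?case
      using insert by (auto intro!: g_add g_single pm.subspace_sum[OF subspace_coord_space])
  qed (simp add: g_zero)
  from this[of "Poly_Mapping.keys v"] v show ?thesis
    by (simp add: g_def poly_mapping_sum_monomials coord_space_def)
qed

text \<open>Both the free algebra and its tensor square are convolution algebras of monoids of
  words. This covers the multiplicativity of the actions of both.\<close>

lemma lin_ext_convolution_action:
  fixes act :: "'w::monoid_add \<Rightarrow> ('b \<Rightarrow>\<^sub>0 'k::field) \<Rightarrow> ('b \<Rightarrow>\<^sub>0 'k)"
  assumes lin: "\<And>w. pm_linear (act w)" and act_add: "\<And>u w v. act (u + w) v = act u (act w v)"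
  shows "lin_ext (\<lambda>w. act w v) (p * p') = lin_ext (\<lambda>w. act w (lin_ext (\<lambda>w. act w v) p')) p"
proof -
  have single: "lin_ext (\<lambda>w. act w v) (Poly_Mapping.single a c * p') =
      pm_scale c (act a (lin_ext (\<lambda>w. act w v) p'))" for a c
  proof -
    have "Poly_Mapping.single a c * p' = Poly_Mapping.single a c *
        (\<Sum>b\<in>Poly_Mapping.keys p'. Poly_Mapping.single b (Poly_Mapping.lookup p' b))"
      by (simp add: poly_mapping_sum_monomials)
    then show ?thesis
      by (simp add: sum_distrib_left mult_single lin_ext_sum act_add pm_linear_on_lin_ext[OF lin])
        (simp add: lin_ext_def pm.scale_sum_right)
  qed
  have "p * p' = (\<Sum>a\<in>Poly_Mapping.keys p. Poly_Mapping.single a (Poly_Mapping.lookup p a)) * p'"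
    by (simp add: poly_mapping_sum_monomials)
  then show ?thesis
    by (simp add: sum_distrib_right lin_ext_sum single) (simp add: lin_ext_def)
qed


section \<open>Left modules, submodules and isomorphisms\<close>

context left_module
begin

lemma smult_zero_left: "x \<in> carrier M \<Longrightarrow> \<zero>\<^bsub>R\<^esub> \<odot>\<^bsub>M\<^esub> x = \<zero>\<^bsub>M\<^esub>"
  using smult_l_distr[of "\<zero>\<^bsub>R\<^esub>" "\<zero>\<^bsub>R\<^esub>" x] smult_closed[of "\<zero>\<^bsub>R\<^esub>" x]
    M.add.l_cancel_one[of "\<zero>\<^bsub>R\<^esub> \<odot>\<^bsub>M\<^esub> x" "\<zero>\<^bsub>R\<^esub> \<odot>\<^bsub>M\<^esub> x"] by simp

lemma smult_minus_one: "x \<in> carrier M \<Longrightarrow> (\<ominus>\<^bsub>R\<^esub> \<one>\<^bsub>R\<^esub>) \<odot>\<^bsub>M\<^esub> x = \<ominus>\<^bsub>M\<^esub> x"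
proof -
  assume x: "x \<in> carrier M"
  have "(\<ominus>\<^bsub>R\<^esub> \<one>\<^bsub>R\<^esub>) \<odot>\<^bsub>M\<^esub> x \<oplus>\<^bsub>M\<^esub> x = \<zero>\<^bsub>M\<^esub>"
    using smult_l_distr[of "\<ominus>\<^bsub>R\<^esub> \<one>\<^bsub>R\<^esub>" "\<one>\<^bsub>R\<^esub>" x] x
    by (simp add: smult_one R.l_neg smult_zero_left)
  then show ?thesis
    using M.minus_equality[of "(\<ominus>\<^bsub>R\<^esub> \<one>\<^bsub>R\<^esub>) \<odot>\<^bsub>M\<^esub> x" x] x smult_closed by simp
qed

text \<open>Closure under scalar multiples includes closure under negation, as
  $-x = (-1)x$.\<close>

lemma submodule_iff:
  "submodule N R M \<longleftrightarrow> N \<subseteq> carrier M \<and> \<zero>\<^bsub>M\<^esub> \<in> N \<and>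
    (\<forall>x\<in>N. \<forall>y\<in>N. x \<oplus>\<^bsub>M\<^esub> y \<in> N) \<and> (\<forall>a\<in>carrier R. \<forall>x\<in>N. a \<odot>\<^bsub>M\<^esub> x \<in> N)"
  (is "_ \<longleftrightarrow> ?closed")
proof
  assume "submodule N R M"
  then interpret submodule N R M .
  show ?closed
    using subset one_closed m_closed smult_closed by auto
next
  assume closed: ?closed
  have "\<ominus>\<^bsub>M\<^esub> x \<in> N" if "x \<in> N" for x
    using closed that smult_minus_one[of x] R.a_inv_closed[OF R.one_closed] by (metis subsetD)
  then show "submodule N R M"
    using closed by (auto intro!: submodule.intro subgroup.intro submodule_axioms.intro simp: a_inv_def)
qed

lemma left_module_submodule:
  assumes "submodule W R M"
  shows "left_module R (M\<lparr>carrier := W\<rparr>)"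
proof -
  have W: "W \<subseteq> carrier M" "\<zero>\<^bsub>M\<^esub> \<in> W" "\<And>x y. x \<in> W \<Longrightarrow> y \<in> W \<Longrightarrow> x \<oplus>\<^bsub>M\<^esub> y \<in> W"
    "\<And>a x. a \<in> carrier R \<Longrightarrow> x \<in> W \<Longrightarrow> a \<odot>\<^bsub>M\<^esub> x \<in> W"
    using assms by (auto simp: submodule_iff)
  have minus: "\<exists>y\<in>W. y \<oplus>\<^bsub>M\<^esub> x = \<zero>\<^bsub>M\<^esub>" if "x \<in> W" for x
    using W that smult_minus_one[of x] M.l_neg[of x] R.a_inv_closed[OF R.one_closed] by (metis subsetD)
  have "abelian_group (M\<lparr>carrier := W\<rparr>)"
    using W minus by (intro abelian_groupI) (auto simp: M.a_ac subset_iff)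
  then show ?thesis
    using W(1) smult_l_distr smult_r_distr smult_assoc smult_one
    by (intro left_module.intro left_module_axioms.intro R.ring_axioms)
      (auto simp: W(4) subset_iff)
qed

lemma submodule_of_submodule_iff:
  assumes "submodule W R M"
  shows "submodule N R (M\<lparr>carrier := W\<rparr>) \<longleftrightarrow> submodule N R M \<and> N \<subseteq> W"
  using left_module.submodule_iff[OF left_module_submodule[OF assms], of N] assms
  by (auto simp: submodule_iff subset_iff)

lemma has_simple_direct_summand_iff:
  "has_simple_direct_summand R M \<longleftrightarrow> (\<exists>W U. submodule W R M \<and> submodule U R M \<and>
    W \<inter> U = {\<zero>\<^bsub>M\<^esub>} \<and> W <+>\<^bsub>M\<^esub> U = carrier M \<and> W \<noteq> {\<zero>\<^bsub>M\<^esub>} \<and>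
    (\<forall>N. submodule N R M \<longrightarrow> N \<subseteq> W \<longrightarrow> N = {\<zero>\<^bsub>M\<^esub>} \<or> N = W))"
  unfolding has_simple_direct_summand_def direct_summand_def simple_module_def
  by (simp add: submodule_of_submodule_iff left_module_submodule cong: conj_cong) blast

end

text \<open>The module axioms are transported to the target along the bijection. For a quotient
  such as a tensor product this replaces a check of every axiom on cosets.\<close>

locale left_module_iso = M: left_module R M
  for R :: "('a, 'c) ring_scheme" and M :: "('a, 'b, 'd) module_scheme" +
  fixes M' :: "('a, 'b2, 'd2) module_scheme" and f :: "'b \<Rightarrow> 'b2"
  assumes bij: "bij_betw f (carrier M) (carrier M')"
    and map_add: "\<lbrakk>x \<in> carrier M; y \<in> carrier M\<rbrakk> \<Longrightarrow> f (x \<oplus>\<^bsub>M\<^esub> y) = f x \<oplus>\<^bsub>M'\<^esub> f y"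
    and map_smult: "\<lbrakk>a \<in> carrier R; x \<in> carrier M\<rbrakk> \<Longrightarrow> f (a \<odot>\<^bsub>M\<^esub> x) = a \<odot>\<^bsub>M'\<^esub> f x"
    and map_zero: "f \<zero>\<^bsub>M\<^esub> = \<zero>\<^bsub>M'\<^esub>"
begin

lemma image_carrier: "carrier M' = f ` carrier M"
  using bij by (simp add: bij_betw_def)

lemma target_left_module: "left_module R M'"
proof -
  note hom = map_add[symmetric] map_smult[symmetric] map_zero[symmetric]
  have minus: "\<exists>y\<in>carrier M. f (y \<oplus>\<^bsub>M\<^esub> x) = f \<zero>\<^bsub>M\<^esub>" if "x \<in> carrier M" for x
    using that by (intro bexI[of _ "\<ominus>\<^bsub>M\<^esub> x"]) (auto simp: M.M.l_neg)
  have "abelian_group M'"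
    using minus by (intro abelian_groupI) (auto simp: image_carrier hom M.M.a_ac)
  moreover have "left_module_axioms R M'"
    by unfold_locales
      (auto simp: image_carrier hom M.smult_closed M.smult_l_distr M.smult_r_distr M.smult_assoc
        M.smult_one)
  ultimately show ?thesis
    by (intro left_module.intro M.R.ring_axioms)
qed

lemma inverse_iso: "left_module_iso R M' M (inv_into (carrier M) f)"
proof -
  have inv: "inv_into (carrier M) f (f x) = x" if "x \<in> carrier M" for x
    using that bij by (simp add: bij_betw_def)
  note hom = map_add[symmetric] map_smult[symmetric] map_zero[symmetric]
  show ?thesis
    by (intro left_module_iso.intro target_left_module left_module_iso_axioms.intro
        bij_betw_inv_into bij)
      (auto simp: image_carrier hom inv M.smult_closed)
qed

lemma submodule_image:
  assumes "submodule N R M"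
  shows "submodule (f ` N) R M'"
  using assms unfolding M.submodule_iff left_module.submodule_iff[OF target_left_module]
  by (auto simp: image_carrier subset_iff map_add[symmetric] map_smult[symmetric]
      map_zero[symmetric])

lemma submodule_preimage:
  assumes "submodule W R M" "submodule N' R M'"
  shows "submodule {x \<in> W. f x \<in> N'} R M"
  using assms unfolding M.submodule_iff left_module.submodule_iff[OF target_left_module]
  by (auto simp: subset_iff map_add map_smult map_zero)

lemma has_simple_direct_summand_image:
  assumes "has_simple_direct_summand R M"
  shows "has_simple_direct_summand R M'"
proof -
  obtain W U where WU: "submodule W R M" "submodule U R M" "W \<inter> U = {\<zero>\<^bsub>M\<^esub>}"
      "W <+>\<^bsub>M\<^esub> U = carrier M" "W \<noteq> {\<zero>\<^bsub>M\<^esub>}"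
    and minimal: "\<And>N. submodule N R M \<Longrightarrow> N \<subseteq> W \<Longrightarrow> N = {\<zero>\<^bsub>M\<^esub>} \<or> N = W"
    using assms unfolding M.has_simple_direct_summand_iff by blast
  have sub: "W \<subseteq> carrier M" "U \<subseteq> carrier M"
    using WU by (auto simp: M.submodule_iff)
  have inj: "inj_on f (carrier M)"
    using bij by (simp add: bij_betw_def)
  have "f ` W \<inter> f ` U = {\<zero>\<^bsub>M'\<^esub>}"
    using inj_on_image_Int[OF inj sub] WU(3) map_zero by auto
  moreover have "f ` W <+>\<^bsub>M'\<^esub> f ` U = carrier M'"
  proof -
    have "f ` W <+>\<^bsub>M'\<^esub> f ` U = f ` (W <+>\<^bsub>M\<^esub> U)"
      using sub by (force simp: set_add_def set_mult_def map_add subset_iff)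
    then show ?thesis
      by (simp add: WU(4) image_carrier)
  qed
  moreover have "f ` W \<noteq> {\<zero>\<^bsub>M'\<^esub>}"
  proof
    assume "f ` W = {\<zero>\<^bsub>M'\<^esub>}"
    then have "f x = f \<zero>\<^bsub>M\<^esub>" if "x \<in> W" for x
      using that map_zero by auto
    then have "W \<subseteq> {\<zero>\<^bsub>M\<^esub>}"
      using inj_onD[OF inj] sub(1) M.M.zero_closed by blast
    then show False
      using WU(1,5) by (auto simp: M.submodule_iff)
  qed
  moreover have "N' = {\<zero>\<^bsub>M'\<^esub>} \<or> N' = f ` W" if "submodule N' R M'" "N' \<subseteq> f ` W" for N'
  proof -
    have "N' = f ` {x \<in> W. f x \<in> N'}"
      using that(2) by auto
    then show ?thesis
      using minimal[OF submodule_preimage[OF WU(1) that(1)]] map_zero by auto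
  qed
  ultimately show ?thesis
    unfolding left_module.has_simple_direct_summand_iff[OF target_left_module]
    using submodule_image[OF WU(1)] submodule_image[OF WU(2)] by blast
qed

lemma has_simple_direct_summand_iso:
  "has_simple_direct_summand R M \<longleftrightarrow> has_simple_direct_summand R M'"
  using has_simple_direct_summand_image
    left_module_iso.has_simple_direct_summand_image[OF inverse_iso] by blast

end


section \<open>Taft modules given by two operators\<close>

text \<open>Both the modules $M(l,r)$ and, in suitable coordinates, their tensor products consist
  of a coordinate subspace of a free vector space with two operators through which $g$ and $h$
  act.\<close>

definition free_action ::
    "(('b \<Rightarrow>\<^sub>0 'k::field) \<Rightarrow> ('b \<Rightarrow>\<^sub>0 'k)) \<Rightarrow> (('b \<Rightarrow>\<^sub>0 'k) \<Rightarrow> ('b \<Rightarrow>\<^sub>0 'k)) \<Rightarrow>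
      'k free_elt \<Rightarrow> ('b \<Rightarrow>\<^sub>0 'k) \<Rightarrow> ('b \<Rightarrow>\<^sub>0 'k)"
  where "free_action G H p v = lin_ext (\<lambda>w. word_action G H w v) p"

definition operator_module ::
    "(('b \<Rightarrow>\<^sub>0 'k::field) \<Rightarrow> ('b \<Rightarrow>\<^sub>0 'k)) \<Rightarrow> (('b \<Rightarrow>\<^sub>0 'k) \<Rightarrow> ('b \<Rightarrow>\<^sub>0 'k)) \<Rightarrow> 'b set \<Rightarrow>
      ('k free_elt set, 'b \<Rightarrow>\<^sub>0 'k) module"
  where "operator_module G H S =
    \<lparr>carrier = coord_space S, mult = undefined, one = undefined, zero = 0, add = (+),
     smult = (\<lambda>X. free_action G H (SOME p. p \<in> X))\<rparr>"

lemma operator_module_simps [simp]: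
  "carrier (operator_module G H S) = coord_space S"
  "\<zero>\<^bsub>operator_module G H S\<^esub> = 0"
  "x \<oplus>\<^bsub>operator_module G H S\<^esub> y = x + y"
  by (simp_all add: operator_module_def)

lemma taft_M_eq_operator_module:
  "taft_M n q l r = operator_module (taft_M_g q r) (taft_M_h l) {1..l}"
  by (simp add: taft_M_def operator_module_def coord_space_def free_action_def fun_eq_iff)

lemma word_action_zero [simp]: "word_action G H 0 v = v"
  by (simp add: zero_taft_word_def)

lemma word_action_add: "word_action G H (u + w) v = word_action G H u (word_action G H w v)"
  by (cases u; cases w) simp

lemma taft_class_ring_hom: "taft_class n q \<in> ring_hom free_algebra (taft_algebra n q)"
  using ideal.rcos_ring_hom[OF ideal_taft_ideal] unfolding taft_class_def taft_algebra_def .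

lemma taft_class_closed: "taft_class n q p \<in> carrier (taft_algebra n q)"
  by (rule ring_hom_closed[OF taft_class_ring_hom]) (simp add: free_algebra_def)

lemma taft_class_cases:
  assumes "X \<in> carrier (taft_algebra n q)"
  obtains p where "X = taft_class n q p"
  using assms by (auto simp: taft_algebra_def taft_class_def FactRing_def A_RCOSETS_def'
      a_r_coset_def' free_algebra_def)

lemma taft_class_mult:
  "taft_class n q p \<otimes>\<^bsub>taft_algebra n q\<^esub> taft_class n q p' = taft_class n q (p * p')"
  using ring_hom_mult[OF taft_class_ring_hom, of p p' n q] by (simp add: free_algebra_def)

lemma taft_class_add:
  "taft_class n q p \<oplus>\<^bsub>taft_algebra n q\<^esub> taft_class n q p' = taft_class n q (p + p')"
  using ring_hom_add[OF taft_class_ring_hom, of p p' n q] by (simp add: free_algebra_def)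

lemma taft_class_one: "\<one>\<^bsub>taft_algebra n q\<^esub> = taft_class n q 1"
  using ring_hom_one[OF taft_class_ring_hom, of n q] by (simp add: free_algebra_def)

lemma a_inv_free_algebra: "\<ominus>\<^bsub>free_algebra\<^esub> p = - p" for p :: "'k::field free_elt"
proof -
  interpret ring "free_algebra :: 'k free_elt ring"
    by (rule ring_free_algebra)
  show ?thesis
    by (rule minus_equality) (simp_all add: free_algebra_def)
qed

text \<open>The relations of the Taft algebra are required on the whole free vector space and not
  just on the coordinate subspace that carries the module. Operators can then be compared on all
  basis vectors, with no side conditions on indices.\<close>

locale taft_operators =
  fixes n :: nat and q :: "'k::field" and G H :: "('b \<Rightarrow>\<^sub>0 'k) \<Rightarrow> ('b \<Rightarrow>\<^sub>0 'k)" and S :: "'b set"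
  assumes linear_G: "pm_linear G" and linear_H: "pm_linear H"
    and G_power: "(G ^^ n) v = v" and H_power: "(H ^^ n) v = 0"
    and skew: "H (G v) = pm_scale q (G (H v))"
    and G_stable: "v \<in> coord_space S \<Longrightarrow> G v \<in> coord_space S"
    and H_stable: "v \<in> coord_space S \<Longrightarrow> H v \<in> coord_space S"
begin

abbreviation "action \<equiv> free_action G H"

abbreviation "V \<equiv> operator_module G H S"

lemma linear_word_action: "pm_linear (word_action G H w)"
proof (cases w)
  case (Word xs)
  have "pm_linear (word_action G H (Word xs))"
  proof (induction xs)
    case Nil
    show ?case by (rule pm_linearI) auto
  next
    case (Cons x xs)
    have "word_action G H (Word (x # xs)) =
        (\<lambda>v. (case x of Gen_g \<Rightarrow> G | Gen_h \<Rightarrow> H) (word_action G H (Word xs) v))"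
      by (simp add: fun_eq_iff)
    then show ?case
      using Cons pm_linear_comp linear_G linear_H by (cases x) auto
  qed
  with Word show ?thesis by simp
qed

lemma linear_action: "pm_linear (action p)"
  unfolding free_action_def by (rule pm_linear_lin_ext_pointwise) (rule linear_word_action)

lemma action_add: "action (p + p') v = action p v + action p' v"
  by (simp add: free_action_def lin_ext_add)

lemma action_diff: "action (p - p') v = action p v - action p' v"
  by (simp add: free_action_def lin_ext_diff)

lemma action_mult: "action (p * p') v = action p (action p' v)"
  unfolding free_action_def
  by (rule lin_ext_convolution_action) (simp_all add: linear_word_action word_action_add)

lemma action_single: "action (Poly_Mapping.single w c) v = pm_scale c (word_action G H w v)"
  by (simp add: free_action_def)

lemma action_const: "action (free_const c) v = pm_scale c v"
  by (simp add: free_const_def action_single)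

lemma action_one: "action 1 v = v"
  using action_const[of 1 v] by (simp add: free_const_def)

lemma action_gen_g: "action (free_gen Gen_g) v = G v"
  by (simp add: free_gen_def action_single)

lemma action_gen_h: "action (free_gen Gen_h) v = H v"
  by (simp add: free_gen_def action_single)

lemma action_power: "action (p ^ m) v = (action p ^^ m) v"
  by (induction m) (simp_all add: action_one action_mult)

text \<open>The elements of the free algebra that act as zero form an ideal, and the relations of
  the Taft algebra lie in it.\<close>

lemma action_taft_ideal:
  assumes "p \<in> taft_ideal n q"
  shows "action p v = 0"
proof -
  define Ann where "Ann = {p. \<forall>v. action p v = 0}"
  have "subgroup Ann (add_monoid (free_algebra :: 'k free_elt ring))"
  proof
    fix x
    assume "x \<in> Ann"
    then show "inv\<^bsub>add_monoid free_algebra\<^esub> x \<in> Ann"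
      using a_inv_free_algebra[of x] action_diff[of 0 x] action_diff[of 0 0]
      by (auto simp: Ann_def a_inv_def)
  qed (use action_diff[of 0 0] in \<open>auto simp: Ann_def free_algebra_def action_add\<close>)
  then have "ideal Ann free_algebra"
    by (intro idealI[OF ring_free_algebra])
      (auto simp: Ann_def free_algebra_def action_mult pm_pair.linear_0[OF linear_action])
  moreover have "{free_gen Gen_g ^ n - 1, free_gen Gen_h ^ n,
      free_gen Gen_h * free_gen Gen_g - free_const q * free_gen Gen_g * free_gen Gen_h} \<subseteq> Ann"
    using G_power H_power skew
    by (simp add: Ann_def action_diff action_power action_one action_mult action_const
        action_gen_g action_gen_h ext[OF action_gen_g] ext[OF action_gen_h])
  ultimately have "taft_ideal n q \<subseteq> Ann"
    unfolding taft_ideal_def by (rule ring.genideal_minimal[OF ring_free_algebra])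
  then show ?thesis
    using assms by (auto simp: Ann_def)
qed

text \<open>Two representatives of a coset differ by an element of the ideal, which acts as
  zero.\<close>

lemma action_representative: "action (SOME p'. p' \<in> taft_class n q p) = action p"
proof
  fix v
  have mem: "p' \<in> taft_class n q p \<longleftrightarrow> (\<exists>i\<in>taft_ideal n q. p' = i + p)" for p'
    by (simp add: taft_class_def a_r_coset_def' free_algebra_def)
  have "0 \<in> taft_ideal n q"
    using additive_subgroup.zero_closed[OF ideal.axioms(1)[OF ideal_taft_ideal]]
    by (simp add: free_algebra_def)
  then have "\<exists>p'. p' \<in> taft_class n q p"
    unfolding mem by blast
  then have "(SOME p'. p' \<in> taft_class n q p) \<in> taft_class n q p"
    by (rule someI_ex)
  then show "action (SOME p'. p' \<in> taft_class n q p) v = action p v"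
    unfolding mem by (auto simp: action_add action_taft_ideal)
qed

lemma smult_taft_class: "taft_class n q p \<odot>\<^bsub>V\<^esub> v = action p v"
  by (simp add: operator_module_def action_representative)

lemma word_action_stable:
  assumes W: "pm.subspace W" "\<And>v. v \<in> W \<Longrightarrow> G v \<in> W" "\<And>v. v \<in> W \<Longrightarrow> H v \<in> W" "v \<in> W"
  shows "word_action G H w v \<in> W"
proof (cases w)
  case (Word xs)
  have "word_action G H (Word xs) v \<in> W"
    using W by (induction xs) (auto split: taft_gen.split)
  with Word show ?thesis by simp
qed

lemma action_stable:
  assumes W: "pm.subspace W" "\<And>v. v \<in> W \<Longrightarrow> G v \<in> W" "\<And>v. v \<in> W \<Longrightarrow> H v \<in> W" "v \<in> W"
  shows "action p v \<in> W"
  unfolding free_action_def using W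
  by (intro lin_ext_in_subspace word_action_stable) auto

lemma action_closed: "v \<in> coord_space S \<Longrightarrow> action p v \<in> coord_space S"
  by (rule action_stable) (auto simp: subspace_coord_space G_stable H_stable)

lemma left_module_operator_module: "left_module (taft_algebra n q) V"
proof -
  have "\<exists>y\<in>coord_space S. y + x = 0" if "x \<in> coord_space S" for x :: "'b \<Rightarrow>\<^sub>0 'k"
    using pm.subspace_neg[OF subspace_coord_space that] by (intro bexI[of _ "- x"]) simp_all
  then have "abelian_group V"
    using pm.subspace_0[OF subspace_coord_space] pm.subspace_add[OF subspace_coord_space]
    by (intro abelian_groupI) (auto simp: add_ac)
  moreover have "left_module_axioms (taft_algebra n q) V"
    by unfold_locales
      (auto elim!: taft_class_cases simp: smult_taft_class taft_class_mult taft_class_add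
        taft_class_one action_closed action_add action_mult action_one
        pm_pair.linear_add[OF linear_action])
  ultimately show ?thesis
    by (intro left_module.intro ring_taft_algebra)
qed

text \<open>The scalars, $g$ and $h$ generate the free algebra, so stability under these is
  enough.\<close>

lemma submodule_iff_stable_subspace:
  "submodule W (taft_algebra n q) V \<longleftrightarrow>
    W \<subseteq> coord_space S \<and> pm.subspace W \<and> (\<forall>v\<in>W. G v \<in> W) \<and> (\<forall>v\<in>W. H v \<in> W)"
  (is "_ \<longleftrightarrow> ?stable")
proof -
  have smult: "(\<forall>a\<in>carrier (taft_algebra n q). \<forall>x\<in>W. a \<odot>\<^bsub>V\<^esub> x \<in> W) \<longleftrightarrow> (\<forall>p. \<forall>x\<in>W. action p x \<in> W)"
    by (metis smult_taft_class taft_class_cases taft_class_closed)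
  have "?stable" if "W \<subseteq> coord_space S" "0 \<in> W" "\<forall>x\<in>W. \<forall>y\<in>W. x + y \<in> W"
    and act: "\<forall>p. \<forall>x\<in>W. action p x \<in> W"
    using that(1-3) act[rule_format, of _ "free_const c" for c] act[rule_format, of _ "free_gen x" for x]
    by (auto intro!: pm.subspaceI simp: action_const[symmetric] action_gen_g[symmetric] action_gen_h[symmetric])
  moreover have "0 \<in> W \<and> (\<forall>x\<in>W. \<forall>y\<in>W. x + y \<in> W) \<and> (\<forall>p. \<forall>x\<in>W. action p x \<in> W)" if ?stable
    using that by (auto intro: action_stable pm.subspace_0 pm.subspace_add)
  ultimately show ?thesis
    unfolding left_module.submodule_iff[OF left_module_operator_module] smult
    by auto
qed

end


section \<open>The quantum binomial theorem at a root of unity\<close>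

fun q_binomial :: "'k::field \<Rightarrow> nat \<Rightarrow> nat \<Rightarrow> 'k"
  where
    "q_binomial q m 0 = 1"
  | "q_binomial q 0 (Suc k) = 0"
  | "q_binomial q (Suc m) (Suc k) = q ^ Suc k * q_binomial q m (Suc k) + q_binomial q m k"

text \<open>This is the usual $q$-factorial $[m]_q!$ multiplied by $(1-q)^m$. Without the
  denominators, the identities hold for every $q$ and the vanishing at roots of unity is visible
  factor by factor.\<close>

definition q_factorial :: "'k::field \<Rightarrow> nat \<Rightarrow> 'k"
  where "q_factorial q m = (\<Prod>i<m. 1 - q ^ Suc i)"

lemma q_factorial_Suc: "q_factorial q (Suc m) = q_factorial q m * (1 - q ^ Suc m)"
  by (simp add: q_factorial_def)

lemma q_binomial_eq_0: "m < k \<Longrightarrow> q_binomial q m k = 0"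
  by (induction q m k rule: q_binomial.induct) auto

text \<open>With $[m] = 1 - q^m$, the recursion for the binomial coefficients reproduces the
  factorials because $q^b [a] + [b] = [a + b]$.\<close>

lemma q_binomial_factorial:
  "q_binomial q (a + b) b * q_factorial q b * q_factorial q a = q_factorial q (a + b)"
proof (induction "a + b" arbitrary: a b)
  case 0
  then show ?case by (simp add: q_factorial_def)
next
  case (Suc m)
  show ?case
  proof (cases b)
    case 0
    then show ?thesis by (simp add: q_factorial_def)
  next
    case b: (Suc b')
    have right: "q_binomial q m b' * q_factorial q b' * q_factorial q a = q_factorial q m"
      using Suc(1)[of a b'] Suc(2) b by simp
    have left: "q_binomial q m b * q_factorial q b * q_factorial q a = q_factorial q m * (1 - q ^ a)"
    proof (cases a)
      case 0
      then show ?thesis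
        using Suc(2) q_binomial_eq_0[of m b q] by simp
    next
      case (Suc a')
      then show ?thesis
        using Suc.hyps(1)[of a' b] Suc.hyps(2) by (simp add: q_factorial_Suc algebra_simps)
    qed
    have "q_binomial q (a + b) b * q_factorial q b * q_factorial q a =
        q ^ b * (q_binomial q m b * q_factorial q b * q_factorial q a) +
        (q_binomial q m b' * q_factorial q b' * q_factorial q a) * (1 - q ^ b)"
      using Suc(2)[symmetric] b by (simp add: q_factorial_Suc algebra_simps)
    also have "\<dots> = q_factorial q m * (1 - q ^ (a + b))"
      unfolding left right by (simp add: algebra_simps power_add)
    also have "\<dots> = q_factorial q (a + b)"
      by (simp add: Suc(2)[symmetric] q_factorial_Suc)
    finally show ?thesis .
  qed
qed

text \<open>Among the factors $1 - q^i$ with $1 \leq i \leq n$ only the last one is zero, and it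
  occurs in $[n]!$ but not in $[k]!\,[n-k]!$.\<close>

lemma q_binomial_root_of_unity:
  assumes "primitive_root_of_unity n q" "0 < k" "k < n"
  shows "q_binomial q n k = 0"
proof -
  have nz: "q_factorial q j \<noteq> 0" if "j < n" for j
    using assms(1) that by (force simp: q_factorial_def primitive_root_of_unity_def)
  have "q_factorial q n = 0"
    using assms by (cases n) (auto simp: q_factorial_Suc primitive_root_of_unity_def)
  then show ?thesis
    using q_binomial_factorial[of q "n - k" k] nz[of k] nz[of "n - k"] assms by auto
qed

text \<open>Moving a new factor \<open>A\<close> past $B^k$ costs $q^k$, which is the first term
  in the recursion for the coefficients; a new factor \<open>B\<close> already stands in front and
  gives the second term.\<close>

lemma skew_binomial:
  fixes A B :: "('b \<Rightarrow>\<^sub>0 'k::field) \<Rightarrow> ('b \<Rightarrow>\<^sub>0 'k)"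
  assumes A: "pm_linear A" and B: "pm_linear B"
    and skew: "\<And>v. A (B v) = pm_scale q (B (A v))"
  shows "((\<lambda>v. A v + B v) ^^ m) v =
    (\<Sum>k\<le>m. pm_scale (q_binomial q m k) ((B ^^ k) ((A ^^ (m - k)) v)))"
proof (induction m)
  case (Suc m)
  have A_past: "A ((B ^^ k) w) = pm_scale (q ^ k) ((B ^^ k) (A w))" for k w
    by (induction k) (simp_all add: skew pm_pair.linear_scale[OF B])
  define t where "t k = (B ^^ k) ((A ^^ (Suc m - k)) v)" for k
  have A_term: "A ((B ^^ k) ((A ^^ (m - k)) v)) = pm_scale (q ^ k) (t k)" if "k \<le> m" for k
    using that by (simp add: A_past t_def Suc_diff_le)
  have "((\<lambda>v. A v + B v) ^^ Suc m) v =
      (\<Sum>k\<le>m. pm_scale (q_binomial q m k * q ^ k) (t k)) +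
      (\<Sum>k\<le>m. pm_scale (q_binomial q m k) (t (Suc k)))"
  proof -
    have "A (\<Sum>k\<le>m. pm_scale (q_binomial q m k) ((B ^^ k) ((A ^^ (m - k)) v))) =
        (\<Sum>k\<le>m. pm_scale (q_binomial q m k * q ^ k) (t k))"
      unfolding pm_pair.linear_sum[OF A]
      by (rule sum.cong) (simp_all add: pm_pair.linear_scale[OF A] A_term)
    then show ?thesis
      by (simp add: Suc pm_pair.linear_sum[OF B] pm_pair.linear_scale[OF B]) (simp add: t_def)
  qed
  also have "(\<Sum>k\<le>m. pm_scale (q_binomial q m k * q ^ k) (t k)) =
      (\<Sum>k\<le>Suc m. pm_scale (q_binomial q m k * q ^ k) (t k))"
    by (simp add: q_binomial_eq_0)
  also have "\<dots> = t 0 + (\<Sum>k\<le>m. pm_scale (q_binomial q m (Suc k) * q ^ Suc k) (t (Suc k)))"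
    by (subst sum.atMost_Suc_shift) simp
  also have "\<dots> + (\<Sum>k\<le>m. pm_scale (q_binomial q m k) (t (Suc k))) =
      t 0 + (\<Sum>k\<le>m. pm_scale (q_binomial q (Suc m) (Suc k)) (t (Suc k)))"
    by (simp add: pm.scale_left_distrib sum.distrib mult.commute)
  also have "\<dots> = (\<Sum>k\<le>Suc m. pm_scale (q_binomial q (Suc m) k) (t k))"
    by (subst sum.atMost_Suc_shift) simp
  finally show ?case
    by (simp only: t_def)
qed simp

text \<open>The inner coefficients of the binomial expansion of $(A+B)^n$ vanish at the root of
  unity, and the two outer terms are $A^n$ and $B^n$.\<close>

lemma skew_sum_nilpotent:
  fixes A B :: "('b \<Rightarrow>\<^sub>0 'k::field) \<Rightarrow> ('b \<Rightarrow>\<^sub>0 'k)"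
  assumes "pm_linear A" "pm_linear B" "\<And>v. A (B v) = pm_scale q (B (A v))"
    and q: "primitive_root_of_unity n q"
    and A_power: "\<And>v. (A ^^ n) v = 0" and B_power: "\<And>v. (B ^^ n) v = 0"
  shows "((\<lambda>v. A v + B v) ^^ n) v = 0"
proof -
  have "pm_scale (q_binomial q n k) ((B ^^ k) ((A ^^ (n - k)) v)) = 0" if "k \<le> n" for k
  proof (cases "0 < k \<and> k < n")
    case True
    then show ?thesis by (simp add: q_binomial_root_of_unity[OF q])
  next
    case False
    then have "k = 0 \<or> k = n" using that by auto
    then show ?thesis using A_power B_power by auto
  qed
  then show ?thesis
    using skew_binomial[OF assms(1-3)] by (simp add: sum.neutral)
qed


section \<open>Tensor products of operators\<close>

definition outer :: "('b \<Rightarrow>\<^sub>0 'k::field) \<Rightarrow> ('c \<Rightarrow>\<^sub>0 'k) \<Rightarrow> ('b \<times> 'c \<Rightarrow>\<^sub>0 'k)"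
  where "outer x y = lin_ext (\<lambda>i. lin_ext (\<lambda>j. pm_unit (i, j)) y) x"

definition tensor_map ::
    "(('b \<Rightarrow>\<^sub>0 'k::field) \<Rightarrow> ('b' \<Rightarrow>\<^sub>0 'k)) \<Rightarrow> (('c \<Rightarrow>\<^sub>0 'k) \<Rightarrow> ('c' \<Rightarrow>\<^sub>0 'k)) \<Rightarrow>
      ('b \<times> 'c \<Rightarrow>\<^sub>0 'k) \<Rightarrow> ('b' \<times> 'c' \<Rightarrow>\<^sub>0 'k)"
  where "tensor_map A B = lin_ext (\<lambda>(i, j). outer (A (pm_unit i)) (B (pm_unit j)))"

lemma linear_outer_left: "pm_linear (\<lambda>x. outer x y)"
  unfolding outer_def by (rule pm_linear_lin_ext)

lemma linear_outer_right: "pm_linear (outer x)"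
  unfolding outer_def[abs_def] by (rule pm_linear_lin_ext_pointwise) (rule pm_linear_lin_ext)

lemma outer_single [simp]:
  "outer (Poly_Mapping.single i c) (Poly_Mapping.single j d) = Poly_Mapping.single (i, j) (c * d)"
  by (simp add: outer_def)

lemma outer_zero [simp]: "outer 0 y = 0" "outer x 0 = 0"
  by (rule pm_pair.linear_0[OF linear_outer_left] pm_pair.linear_0[OF linear_outer_right])+

lemma outer_closed:
  assumes "x \<in> coord_space S" "y \<in> coord_space S'"
  shows "outer x y \<in> coord_space (S \<times> S')"
  unfolding outer_def using assms
  by (intro lin_ext_in_subspace subspace_coord_space) (auto simp: coord_space_def)

lemma linear_tensor_map: "pm_linear (tensor_map A B)"
  unfolding tensor_map_def by (rule pm_linear_lin_ext)

lemma tensor_map_unit [simp]: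
  "tensor_map A B (pm_unit (i, j)) = outer (A (pm_unit i)) (B (pm_unit j))"
  by (simp add: tensor_map_def)

lemma tensor_map_outer:
  assumes A: "pm_linear A" and B: "pm_linear B"
  shows "tensor_map A B (outer x y) = outer (A x) (B y)"
proof -
  have "tensor_map A B (outer (pm_unit i) y) = outer (A (pm_unit i)) (B y)" for i
    using pm_linear_eqI[OF pm_linear_comp[OF linear_tensor_map linear_outer_right]
        pm_linear_comp[OF linear_outer_right B], of A B "pm_unit i" "A (pm_unit i)" y] by simp
  then show ?thesis
    using pm_linear_eqI[OF pm_linear_comp[OF linear_tensor_map linear_outer_left]
        pm_linear_comp[OF linear_outer_left A], of A B y "B y" x] by simp
qed

lemma tensor_map_comp:
  assumes "pm_linear A" "pm_linear B"
  shows "tensor_map A B (tensor_map A' B' z) = tensor_map (\<lambda>x. A (A' x)) (\<lambda>y. B (B' y)) z"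
  by (rule pm_linear_eqI[OF pm_linear_comp[OF linear_tensor_map linear_tensor_map]
        linear_tensor_map])
    (auto simp: tensor_map_outer[OF assms])

lemma tensor_map_id: "tensor_map (\<lambda>x. x) (\<lambda>y. y) z = z"
  by (rule pm_linear_eqI) (auto simp: linear_tensor_map pm_linear_id)

lemma tensor_map_power:
  fixes A :: "('b \<Rightarrow>\<^sub>0 'k::field) \<Rightarrow> ('b \<Rightarrow>\<^sub>0 'k)" and B :: "('c \<Rightarrow>\<^sub>0 'k) \<Rightarrow> ('c \<Rightarrow>\<^sub>0 'k)"
  assumes "pm_linear A" "pm_linear B"
  shows "(tensor_map A B ^^ m) z = tensor_map (A ^^ m) (B ^^ m) z"
proof (induction m)
  case 0
  then show ?case by (simp add: id_def tensor_map_id)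
next
  case (Suc m)
  then show ?case by (simp add: tensor_map_comp[OF assms] o_def)
qed

lemma tensor_map_zero_left: "(\<And>x. A x = 0) \<Longrightarrow> tensor_map A B z = 0"
  by (simp add: tensor_map_def outer_def lin_ext_zero split_def)
    (simp add: lin_ext_def)

lemma tensor_map_zero_right: "(\<And>y. B y = 0) \<Longrightarrow> tensor_map A B z = 0"
  by (simp add: tensor_map_def outer_def lin_ext_zero split_def)
    (simp add: lin_ext_def)

lemma tensor_map_scale_left: "tensor_map (\<lambda>x. pm_scale c (A x)) B z = pm_scale c (tensor_map A B z)"
  by (rule pm_linear_eqI[where L' = "\<lambda>z. pm_scale c (tensor_map A B z)"])
    (auto simp: linear_tensor_map pm_pair.linear_compose_scale_right
      pm_pair.linear_scale[OF linear_outer_left])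

lemma tensor_map_scale_right: "tensor_map A (\<lambda>y. pm_scale c (B y)) z = pm_scale c (tensor_map A B z)"
  by (rule pm_linear_eqI[where L' = "\<lambda>z. pm_scale c (tensor_map A B z)"])
    (auto simp: linear_tensor_map pm_pair.linear_compose_scale_right
      pm_pair.linear_scale[OF linear_outer_right])

lemma tensor_map_closed:
  assumes "\<And>x. x \<in> coord_space S \<Longrightarrow> A x \<in> coord_space S"
    and "\<And>y. y \<in> coord_space S' \<Longrightarrow> B y \<in> coord_space S'"
    and "z \<in> coord_space (S \<times> S')"
  shows "tensor_map A B z \<in> coord_space (S \<times> S')"
  by (rule pm_linear_preserves_coord_space[OF linear_tensor_map _ assms(3)])
    (auto intro!: outer_closed assms(1,2))


section \<open>The tensor product of two Taft modules\<close>

text \<open>The operator by which $\Delta(h) = 1 \otimes h + h \otimes g$ acts on a tensor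
  product; that of $\Delta(g)$ is \<open>tensor_map G1 G2\<close>.\<close>

definition tensor_h ::
    "(('b \<Rightarrow>\<^sub>0 'k::field) \<Rightarrow> ('b \<Rightarrow>\<^sub>0 'k)) \<Rightarrow> (('c \<Rightarrow>\<^sub>0 'k) \<Rightarrow> ('c \<Rightarrow>\<^sub>0 'k)) \<Rightarrow>
      (('c \<Rightarrow>\<^sub>0 'k) \<Rightarrow> ('c \<Rightarrow>\<^sub>0 'k)) \<Rightarrow> ('b \<times> 'c \<Rightarrow>\<^sub>0 'k) \<Rightarrow> ('b \<times> 'c \<Rightarrow>\<^sub>0 'k)"
  where "tensor_h H1 G2 H2 z = tensor_map (\<lambda>x. x) H2 z + tensor_map H1 G2 z"

text \<open>A formal combination of pairs has coordinates with respect to the basis $b \otimes b'$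
  (\<open>tensor_eval\<close>), and coordinates have a standard representative
  (\<open>tensor_lift\<close>). The two maps turn out to be inverse to each other modulo the
  bilinearity relations.\<close>

definition tensor_eval :: "(('b \<Rightarrow>\<^sub>0 'k::field) \<times> ('c \<Rightarrow>\<^sub>0 'k) \<Rightarrow>\<^sub>0 'k) \<Rightarrow> ('b \<times> 'c \<Rightarrow>\<^sub>0 'k)"
  where "tensor_eval = lin_ext (\<lambda>(x, y). outer x y)"

lemma linear_tensor_eval: "pm_linear tensor_eval"
  unfolding tensor_eval_def by (rule pm_linear_lin_ext)

lemma tensor_eval_pair [simp]: "tensor_eval (tensor_pair x y) = outer x y"
  by (simp add: tensor_eval_def tensor_pair_def)

definition tensor_lift :: "('b \<times> 'c \<Rightarrow>\<^sub>0 'k::field) \<Rightarrow> (('b \<Rightarrow>\<^sub>0 'k) \<times> ('c \<Rightarrow>\<^sub>0 'k) \<Rightarrow>\<^sub>0 'k)"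
  where "tensor_lift = lin_ext (\<lambda>(i, j). tensor_pair (pm_unit i) (pm_unit j))"

lemma linear_tensor_lift: "pm_linear tensor_lift"
  unfolding tensor_lift_def by (rule pm_linear_lin_ext)

lemma tensor_eval_lift: "tensor_eval (tensor_lift z) = z"
  by (rule pm_linear_eqI[OF pm_linear_comp[OF linear_tensor_eval linear_tensor_lift] pm_linear_id])
    (auto simp: tensor_lift_def)

lemma tensor_lift_outer:
  "tensor_lift (outer x y) = lin_ext (\<lambda>i. lin_ext (\<lambda>j. tensor_pair (pm_unit i) (pm_unit j)) y) x"
  by (simp add: outer_def pm_linear_on_lin_ext[OF linear_tensor_lift]) (simp add: tensor_lift_def)

locale taft_operators_pair =
  L: taft_operators n q G1 H1 S1 + R: taft_operators n q G2 H2 S2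
  for n :: nat and q :: "'k::field"
    and G1 H1 :: "('b \<Rightarrow>\<^sub>0 'k) \<Rightarrow> ('b \<Rightarrow>\<^sub>0 'k)" and S1 :: "'b set"
    and G2 H2 :: "('c \<Rightarrow>\<^sub>0 'k) \<Rightarrow> ('c \<Rightarrow>\<^sub>0 'k)" and S2 :: "'c set" +
  assumes primitive: "primitive_root_of_unity n q"
begin

lemma linear_tensor_h: "pm_linear (tensor_h H1 G2 H2)"
  unfolding tensor_h_def[abs_def] by (intro pm_pair.linear_compose_add linear_tensor_map)

lemma tensor_h_power: "(tensor_h H1 G2 H2 ^^ n) z = 0"
  unfolding tensor_h_def[abs_def]
proof (rule skew_sum_nilpotent[OF linear_tensor_map linear_tensor_map _ primitive])
  fix v
  show "tensor_map (\<lambda>x. x) H2 (tensor_map H1 G2 v) =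
      pm_scale q (tensor_map H1 G2 (tensor_map (\<lambda>x. x) H2 v))"
    by (simp add: tensor_map_comp pm_linear_id L.linear_H R.linear_G R.linear_H R.skew
        tensor_map_scale_right)
  show "(tensor_map (\<lambda>x. x) H2 ^^ n) v = 0"
    by (simp add: tensor_map_power pm_linear_id R.linear_H tensor_map_zero_right R.H_power)
  show "(tensor_map H1 G2 ^^ n) v = 0"
    by (simp add: tensor_map_power L.linear_H R.linear_G tensor_map_zero_left L.H_power)
qed

sublocale T: taft_operators n q "tensor_map G1 G2" "tensor_h H1 G2 H2" "S1 \<times> S2"
proof (rule taft_operators.intro)
  show "pm_linear (tensor_map G1 G2)" "pm_linear (tensor_h H1 G2 H2)"
    by (rule linear_tensor_map linear_tensor_h)+
  fix z
  show "(tensor_map G1 G2 ^^ n) z = z"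
    using tensor_map_id by (simp add: tensor_map_power L.linear_G R.linear_G ext[OF L.G_power] ext[OF R.G_power])
  show "(tensor_h H1 G2 H2 ^^ n) z = 0"
    by (rule tensor_h_power)
  show "tensor_h H1 G2 H2 (tensor_map G1 G2 z) =
      pm_scale q (tensor_map G1 G2 (tensor_h H1 G2 H2 z))"
    by (simp add: tensor_h_def tensor_map_comp pm_linear_id L.linear_G L.linear_H R.linear_G
        R.linear_H L.skew R.skew tensor_map_scale_left tensor_map_scale_right
        pm_pair.linear_add[OF linear_tensor_map] pm.scale_right_distrib)
  assume z: "z \<in> coord_space (S1 \<times> S2)"
  show "tensor_map G1 G2 z \<in> coord_space (S1 \<times> S2)"
    by (rule tensor_map_closed[OF L.G_stable R.G_stable z])
  show "tensor_h H1 G2 H2 z \<in> coord_space (S1 \<times> S2)"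
    unfolding tensor_h_def
    by (intro pm.subspace_add subspace_coord_space tensor_map_closed z L.H_stable R.G_stable R.H_stable)
qed

abbreviation "formal_tensors \<equiv> coord_space (coord_space S1 \<times> coord_space S2)
  :: (('b \<Rightarrow>\<^sub>0 'k) \<times> ('c \<Rightarrow>\<^sub>0 'k) \<Rightarrow>\<^sub>0 'k) set"

abbreviation "relations \<equiv> tensor_relations n q L.V R.V"

lemma tensor_free_simps [simp]:
  "carrier (tensor_free L.V R.V) = formal_tensors"
  "s \<oplus>\<^bsub>tensor_free L.V R.V\<^esub> s' = s + s'"
  by (simp_all add: tensor_free_def coord_space_def)

lemma base_smult_L: "base_smult n q L.V c x = pm_scale c x"
  by (simp add: base_smult_def L.smult_taft_class L.action_const)

lemma base_smult_R: "base_smult n q R.V c x = pm_scale c x"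
  by (simp add: base_smult_def R.smult_taft_class R.action_const)

lemma subspace_relations: "pm.subspace relations"
  unfolding tensor_relations_def by (rule pm.subspace_span)

lemma relation_add_left:
  assumes "x \<in> coord_space S1" "x' \<in> coord_space S1" "y \<in> coord_space S2"
  shows "tensor_pair (x + x') y - tensor_pair x y - tensor_pair x' y \<in> relations"
  unfolding tensor_relations_def using assms by (intro pm.span_base) auto

lemma relation_add_right:
  assumes "x \<in> coord_space S1" "y \<in> coord_space S2" "y' \<in> coord_space S2"
  shows "tensor_pair x (y + y') - tensor_pair x y - tensor_pair x y' \<in> relations"
  unfolding tensor_relations_def using assms by (intro pm.span_base) auto

lemma relation_scale_left:
  assumes "x \<in> coord_space S1" "y \<in> coord_space S2"
  shows "tensor_pair (pm_scale c x) y - pm_scale c (tensor_pair x y) \<in> relations"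
  unfolding tensor_relations_def base_smult_L using assms by (intro pm.span_base) auto

lemma relation_scale_right:
  assumes "x \<in> coord_space S1" "y \<in> coord_space S2"
  shows "tensor_pair x (pm_scale c y) - pm_scale c (tensor_pair x y) \<in> relations"
  unfolding tensor_relations_def base_smult_R using assms by (intro pm.span_base) auto

lemma tensor_pair_formal:
  "x \<in> coord_space S1 \<Longrightarrow> y \<in> coord_space S2 \<Longrightarrow> tensor_pair x y \<in> formal_tensors"
  unfolding tensor_pair_def by (intro pm_unit_in_coord_space) simp

lemma tensor_lift_formal: "z \<in> coord_space (S1 \<times> S2) \<Longrightarrow> tensor_lift z \<in> formal_tensors"
  unfolding tensor_lift_def
  by (intro lin_ext_in_subspace subspace_coord_space)
    (auto simp: coord_space_def[of "S1 \<times> S2"] intro!: tensor_pair_formal)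

lemma tensor_eval_closed: "s \<in> formal_tensors \<Longrightarrow> tensor_eval s \<in> coord_space (S1 \<times> S2)"
  unfolding tensor_eval_def
  by (intro lin_ext_in_subspace subspace_coord_space)
    (auto simp: coord_space_def[of "coord_space S1 \<times> coord_space S2"] intro!: outer_closed)

text \<open>Taking coordinates is bilinear in the pair, so it kills the generators of the
  relations.\<close>

lemma relations_vanish: "relations \<subseteq> {s \<in> formal_tensors. tensor_eval s = 0}"
  unfolding tensor_relations_def base_smult_L base_smult_R
proof (rule pm.span_minimal)
  note eval = pm_pair.linear_add[OF linear_tensor_eval] pm_pair.linear_diff[OF linear_tensor_eval]
    pm_pair.linear_scale[OF linear_tensor_eval] pm_pair.linear_0[OF linear_tensor_eval]
  note bilinear = pm_pair.linear_add[OF linear_outer_left] pm_pair.linear_scale[OF linear_outer_left]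
    pm_pair.linear_add[OF linear_outer_right] pm_pair.linear_scale[OF linear_outer_right]
  note closed = pm.subspace_add[OF subspace_coord_space] pm.subspace_diff[OF subspace_coord_space]
    pm.subspace_scale[OF subspace_coord_space] pm.subspace_0[OF subspace_coord_space]
  show "pm.subspace {s \<in> formal_tensors. tensor_eval s = 0}"
    by (rule pm.subspaceI) (auto simp: eval closed)
  show "{tensor_pair (x \<oplus>\<^bsub>L.V\<^esub> x') y - tensor_pair x y - tensor_pair x' y |x x' y.
        x \<in> carrier L.V \<and> x' \<in> carrier L.V \<and> y \<in> carrier R.V} \<union>
     {tensor_pair x (y \<oplus>\<^bsub>R.V\<^esub> y') - tensor_pair x y - tensor_pair x y' |x y y'.
        x \<in> carrier L.V \<and> y \<in> carrier R.V \<and> y' \<in> carrier R.V} \<union>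
     {tensor_pair (pm_scale c x) y - pm_scale c (tensor_pair x y) |c x y.
        x \<in> carrier L.V \<and> y \<in> carrier R.V} \<union>
     {tensor_pair x (pm_scale c y) - pm_scale c (tensor_pair x y) |c x y.
        x \<in> carrier L.V \<and> y \<in> carrier R.V} \<subseteq> {s \<in> formal_tensors. tensor_eval s = 0}"
    by (auto simp: eval bilinear intro!: closed tensor_pair_formal)
qed

text \<open>Modulo the relations a pair is linear in each entry, so it can be expanded in basis
  vectors, first on the left and then on the right. The result is the standard representative of
  its coordinates.\<close>

lemma formal_tensor_reduction:
  assumes "s \<in> formal_tensors"
  shows "s - tensor_lift (tensor_eval s) \<in> relations"
proof -
  have pair: "tensor_pair x y - tensor_lift (outer x y) \<in> relations"
    if x: "x \<in> coord_space S1" and y: "y \<in> coord_space S2" for x y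
  proof -
    have left: "tensor_pair x y - lin_ext (\<lambda>i. tensor_pair (pm_unit i) y) x \<in> relations"
      using x y
      by (intro linear_modulo_subspace[where f = "\<lambda>x. tensor_pair x y" and S = S1]
          subspace_relations relation_add_left relation_scale_left)
    have "tensor_pair (pm_unit i) y - lin_ext (\<lambda>j. tensor_pair (pm_unit i) (pm_unit j)) y \<in> relations"
      if "i \<in> S1" for i
      using that y
      by (intro linear_modulo_subspace[where f = "tensor_pair (pm_unit i)" and S = S2]
          subspace_relations relation_add_right relation_scale_right pm_unit_in_coord_space)
    then have "lin_ext (\<lambda>i. tensor_pair (pm_unit i) y -
        lin_ext (\<lambda>j. tensor_pair (pm_unit i) (pm_unit j)) y) x \<in> relations"
      using x by (intro lin_ext_in_subspace subspace_relations) (auto simp: coord_space_def)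
    from pm.subspace_add[OF subspace_relations left this] show ?thesis
      by (simp add: lin_ext_pointwise_diff tensor_lift_outer)
  qed
  have "lin_ext (\<lambda>p. pm_unit p - tensor_lift (tensor_eval (pm_unit p))) s \<in> relations"
  proof (rule lin_ext_in_subspace[OF subspace_relations])
    fix p
    assume "p \<in> Poly_Mapping.keys s"
    then obtain x y where "p = (x, y)" "x \<in> coord_space S1" "y \<in> coord_space S2"
      using assms by (cases p) (auto simp: coord_space_def[of "coord_space S1 \<times> coord_space S2"])
    then show "pm_unit p - tensor_lift (tensor_eval (pm_unit p)) \<in> relations"
      using pair[of x y] tensor_eval_pair[of x y] by (simp add: tensor_pair_def)
  qed
  then show ?thesis
    using pm_linear_eq_lin_ext[OF pm_linear_comp[OF linear_tensor_lift linear_tensor_eval], of s]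
    by (simp add: lin_ext_pointwise_diff lin_ext_unit)
qed

text \<open>The cosets of the relations are the fibers of \<open>tensor_eval\<close>, so the
  elements of the tensor product are indexed by coordinate vectors without a choice of
  representatives.\<close>

definition tensor_fiber :: "('b \<times> 'c \<Rightarrow>\<^sub>0 'k) \<Rightarrow> (('b \<Rightarrow>\<^sub>0 'k) \<times> ('c \<Rightarrow>\<^sub>0 'k) \<Rightarrow>\<^sub>0 'k) set"
  where "tensor_fiber z = {s \<in> formal_tensors. tensor_eval s = z}"

lemma relations_eq_fiber: "relations = tensor_fiber 0"
proof
  show "relations \<subseteq> tensor_fiber 0"
    using relations_vanish by (simp add: tensor_fiber_def)
  show "tensor_fiber 0 \<subseteq> relations"
  proof
    fix s
    assume "s \<in> tensor_fiber 0"
    then have "s \<in> formal_tensors" "tensor_eval s = 0"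
      by (simp_all add: tensor_fiber_def)
    then show "s \<in> relations"
      using formal_tensor_reduction[of s] by (simp add: pm_pair.linear_0[OF linear_tensor_lift])
  qed
qed

lemma coset_eq_fiber:
  assumes "s \<in> formal_tensors"
  shows "relations +>\<^bsub>tensor_free L.V R.V\<^esub> s = tensor_fiber (tensor_eval s)"
proof
  show "relations +>\<^bsub>tensor_free L.V R.V\<^esub> s \<subseteq> tensor_fiber (tensor_eval s)"
    using assms
    by (auto simp: relations_eq_fiber tensor_fiber_def a_r_coset_def'
        pm_pair.linear_add[OF linear_tensor_eval] pm.subspace_add[OF subspace_coord_space])
  show "tensor_fiber (tensor_eval s) \<subseteq> relations +>\<^bsub>tensor_free L.V R.V\<^esub> s"
  proof
    fix s'
    assume "s' \<in> tensor_fiber (tensor_eval s)"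
    then have "s' - s \<in> relations"
      using assms
      by (simp add: relations_eq_fiber tensor_fiber_def
          pm_pair.linear_diff[OF linear_tensor_eval] pm.subspace_diff[OF subspace_coord_space])
    then show "s' \<in> relations +>\<^bsub>tensor_free L.V R.V\<^esub> s"
      by (auto simp: a_r_coset_def' intro!: bexI[of _ "s' - s"])
  qed
qed

lemma tensor_lift_in_fiber: "z \<in> coord_space (S1 \<times> S2) \<Longrightarrow> tensor_lift z \<in> tensor_fiber z"
  by (simp add: tensor_fiber_def tensor_lift_formal tensor_eval_lift)

lemma carrier_taft_tensor: "carrier (taft_tensor n q L.V R.V) = tensor_fiber ` coord_space (S1 \<times> S2)"
proof -
  have "carrier (taft_tensor n q L.V R.V) =
      (\<lambda>s. relations +>\<^bsub>tensor_free L.V R.V\<^esub> s) ` formal_tensors"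
    by (auto simp: taft_tensor_def A_RCOSETS_def' a_r_coset_def')
  also have "\<dots> = (\<lambda>s. tensor_fiber (tensor_eval s)) ` formal_tensors"
    by (rule image_cong) (simp_all add: coset_eq_fiber)
  also have "\<dots> = tensor_fiber ` tensor_eval ` formal_tensors"
    by (simp only: image_image)
  also have "tensor_eval ` formal_tensors = coord_space (S1 \<times> S2)"
  proof
    show "tensor_eval ` formal_tensors \<subseteq> coord_space (S1 \<times> S2)"
      using tensor_eval_closed by blast
    show "coord_space (S1 \<times> S2) \<subseteq> tensor_eval ` formal_tensors"
      using tensor_lift_formal tensor_eval_lift by (metis image_eqI subsetI)
  qed
  finally show ?thesis .
qed

lemma fiber_add:
  assumes "z \<in> coord_space (S1 \<times> S2)"
  shows "tensor_fiber z <+>\<^bsub>tensor_free L.V R.V\<^esub> tensor_fiber z' = tensor_fiber (z + z')"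
proof
  show "tensor_fiber z <+>\<^bsub>tensor_free L.V R.V\<^esub> tensor_fiber z' \<subseteq> tensor_fiber (z + z')"
    by (auto simp: set_add_def' tensor_fiber_def pm_pair.linear_add[OF linear_tensor_eval]
        pm.subspace_add[OF subspace_coord_space])
  show "tensor_fiber (z + z') \<subseteq> tensor_fiber z <+>\<^bsub>tensor_free L.V R.V\<^esub> tensor_fiber z'"
  proof
    fix s
    assume s: "s \<in> tensor_fiber (z + z')"
    then have "s - tensor_lift z \<in> tensor_fiber z'"
      using tensor_lift_in_fiber[OF assms]
      by (simp add: tensor_fiber_def pm_pair.linear_diff[OF linear_tensor_eval]
          pm.subspace_diff[OF subspace_coord_space])
    then show "s \<in> tensor_fiber z <+>\<^bsub>tensor_free L.V R.V\<^esub> tensor_fiber z'"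
      using tensor_lift_in_fiber[OF assms]
      unfolding set_add_def'
      by (intro UN_I[of "tensor_lift z"] UN_I[of "s - tensor_lift z"]) auto
  qed
qed

text \<open>The tensor square of the free algebra acts on coordinates, the element $u \otimes v$
  through the tensor product of the operators of $u$ and $v$.\<close>

definition pair_action ::
    "(taft_word \<times> taft_word \<Rightarrow>\<^sub>0 'k) \<Rightarrow> ('b \<times> 'c \<Rightarrow>\<^sub>0 'k) \<Rightarrow> ('b \<times> 'c \<Rightarrow>\<^sub>0 'k)"
  where "pair_action d z =
    lin_ext (\<lambda>w. tensor_map (word_action G1 H1 (fst w)) (word_action G2 H2 (snd w)) z) d"

lemma pair_action_mult: "pair_action (d * d') z = pair_action d (pair_action d' z)"
  unfolding pair_action_def
  by (rule lin_ext_convolution_action)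
    (simp_all add: linear_tensor_map tensor_map_comp L.linear_word_action R.linear_word_action
      word_action_add)

text \<open>Both the comultiplication and the action are multiplicative, so the comparison reduces
  to the generators.\<close>

lemma pair_action_comult_word:
  "pair_action (comult_word w) z = word_action (tensor_map G1 G2) (tensor_h H1 G2 H2) w z"
proof (cases w)
  case (Word xs)
  have word: "word_action G H (Word []) = (\<lambda>v. v)" "word_action G H (Word [Gen_g]) = G"
    "word_action G H (Word [Gen_h]) = H" for G H :: "('d \<Rightarrow>\<^sub>0 'k) \<Rightarrow> ('d \<Rightarrow>\<^sub>0 'k)"
    by (simp_all add: fun_eq_iff)
  have one: "pair_action 1 z = z" for z
    using tensor_map_id[of z]
    by (simp add: pair_action_def single_one[symmetric] ext[OF word_action_zero] del: single_one)
  have g: "pair_action (comult_gen Gen_g) z = tensor_map G1 G2 z" for z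
    by (simp add: pair_action_def word)
  have h: "pair_action (comult_gen Gen_h) z = tensor_h H1 G2 H2 z" for z
    by (simp add: pair_action_def tensor_h_def lin_ext_add word)
  have "pair_action (comult_word (Word xs)) z =
      word_action (tensor_map G1 G2) (tensor_h H1 G2 H2) (Word xs) z"
  proof (induction xs)
    case (Cons x xs)
    then show ?case
      using g h by (cases x) (simp_all add: pair_action_mult del: comult_gen.simps)
  qed (simp add: one)
  with Word show ?thesis by simp
qed

lemma pair_action_comult: "pair_action (comult p) z = T.action p z"
proof -
  have "pm_linear (\<lambda>d. pair_action d z)"
    unfolding pair_action_def by (rule pm_linear_lin_ext)
  from pm_linear_on_lin_ext[OF this, of comult_word p] show ?thesis
    by (simp add: comult_def free_action_def pair_action_comult_word)
qed

lemma tensor_action_eq: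
  "tensor_action n q L.V R.V d s = lin_ext (\<lambda>w. lin_ext (\<lambda>(x, y).
    tensor_pair (word_action G1 H1 (fst w) x) (word_action G2 H2 (snd w) y)) s) d"
  by (simp add: tensor_action_def L.smult_taft_class R.smult_taft_class L.action_single
      R.action_single split_def)

lemma tensor_action_formal:
  assumes "s \<in> formal_tensors"
  shows "tensor_action n q L.V R.V d s \<in> formal_tensors"
  unfolding tensor_action_eq
proof (intro lin_ext_in_subspace subspace_coord_space)
  fix w and p :: "('b \<Rightarrow>\<^sub>0 'k) \<times> ('c \<Rightarrow>\<^sub>0 'k)"
  assume "p \<in> Poly_Mapping.keys s"
  then have "fst p \<in> coord_space S1" "snd p \<in> coord_space S2"
    using assms by (auto simp: coord_space_def[of "coord_space S1 \<times> coord_space S2"])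
  then show "(case p of (x, y) \<Rightarrow> tensor_pair (word_action G1 H1 (fst w) x)
      (word_action G2 H2 (snd w) y)) \<in> formal_tensors"
    by (auto simp: split_def intro!: tensor_pair_formal L.word_action_stable R.word_action_stable
        subspace_coord_space L.G_stable L.H_stable R.G_stable R.H_stable)
qed

lemma tensor_eval_action: "tensor_eval (tensor_action n q L.V R.V d s) = pair_action d (tensor_eval s)"
proof -
  have "tensor_eval (lin_ext (\<lambda>(x, y).
      tensor_pair (word_action G1 H1 u x) (word_action G2 H2 v y)) s) =
      tensor_map (word_action G1 H1 u) (word_action G2 H2 v) (tensor_eval s)" for u v
  proof -
    have "tensor_map (word_action G1 H1 u) (word_action G2 H2 v) (tensor_eval s) =
        lin_ext (\<lambda>(x, y). outer (word_action G1 H1 u x) (word_action G2 H2 v y)) s"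
      unfolding tensor_eval_def pm_linear_on_lin_ext[OF linear_tensor_map]
      by (simp add: split_def tensor_map_outer L.linear_word_action R.linear_word_action)
    then show ?thesis
      by (simp add: pm_linear_on_lin_ext[OF linear_tensor_eval] split_def)
  qed
  then show ?thesis
    by (simp add: tensor_action_eq pm_linear_on_lin_ext[OF linear_tensor_eval] pair_action_def)
qed

lemma taft_tensor_iso:
  "left_module_iso (taft_algebra n q) T.V (taft_tensor n q L.V R.V) tensor_fiber"
proof (intro left_module_iso.intro T.left_module_operator_module left_module_iso_axioms.intro)
  have "z = z'" if "z \<in> coord_space (S1 \<times> S2)" "tensor_fiber z = tensor_fiber z'" for z z'
    using tensor_lift_in_fiber[OF that(1)] that(2) by (auto simp: tensor_fiber_def)
  then show "bij_betw tensor_fiber (carrier T.V) (carrier (taft_tensor n q L.V R.V))"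
    by (auto simp: bij_betw_def carrier_taft_tensor intro!: inj_onI)
  show "tensor_fiber (z \<oplus>\<^bsub>T.V\<^esub> z') = tensor_fiber z \<oplus>\<^bsub>taft_tensor n q L.V R.V\<^esub> tensor_fiber z'"
    if "z \<in> carrier T.V" for z z'
    using that by (simp add: taft_tensor_def fiber_add)
  show "tensor_fiber \<zero>\<^bsub>T.V\<^esub> = \<zero>\<^bsub>taft_tensor n q L.V R.V\<^esub>"
    by (simp add: taft_tensor_def relations_eq_fiber)
  show "tensor_fiber (X \<odot>\<^bsub>T.V\<^esub> z) = X \<odot>\<^bsub>taft_tensor n q L.V R.V\<^esub> tensor_fiber z"
    if "z \<in> carrier T.V" for X z
  proof -
    define s where "s = (SOME s. s \<in> tensor_fiber z)"
    have "s \<in> tensor_fiber z"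
      unfolding s_def using tensor_lift_in_fiber[of z] that by (metis operator_module_simps(1) someI)
    then have s: "s \<in> formal_tensors" "tensor_eval s = z"
      by (simp_all add: tensor_fiber_def)
    then have "relations +>\<^bsub>tensor_free L.V R.V\<^esub> tensor_action n q L.V R.V (comult p) s =
        tensor_fiber (T.action p z)" for p
      by (simp add: coset_eq_fiber tensor_action_formal tensor_eval_action pair_action_comult)
    then show ?thesis
      by (simp add: taft_tensor_def operator_module_def s_def)
  qed
qed

end


section \<open>A criterion for simple direct summands\<close>

context taft_operators
begin

lemma sum_operator_module: "W <+>\<^bsub>V\<^esub> U = {w + u | w u. w \<in> W \<and> u \<in> U}"
  by (auto simp: set_add_def')

text \<open>The last nonzero vector among $w, Hw, H^2w, \dots$ is the one sought.\<close>

lemma kernel_vector_in_stable_set: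
  assumes W: "\<And>v. v \<in> W \<Longrightarrow> H v \<in> W" and w: "w \<in> W" "w \<noteq> 0"
  obtains v where "v \<in> W" "v \<noteq> 0" "H v = 0"
proof -
  define m where "m = (LEAST m. (H ^^ m) w = 0)"
  have zero: "(H ^^ m) w = 0"
    unfolding m_def by (rule LeastI[of _ n]) (rule H_power)
  with w(2) obtain m' where m: "m = Suc m'"
    by (cases m) auto
  have "(H ^^ m') w \<noteq> 0"
    using not_less_Least[of m' "\<lambda>m. (H ^^ m) w = 0"] m by (simp add: m_def)
  moreover have "(H ^^ j) w \<in> W" for j
    by (induction j) (auto intro: W w)
  ultimately show thesis
    using that zero m by auto
qed

text \<open>A simple summand \<open>W\<close> equals its submodule $W \cap \ker H$. For a
  complement \<open>U\<close>, every element of $\ker H$ lies in $H(W + U) = HU \subseteq U$ by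
  exactness, so $W \subseteq U$.\<close>

lemma no_simple_direct_summand:
  assumes exact: "\<And>v. v \<in> coord_space S \<Longrightarrow> H v = 0 \<Longrightarrow> \<exists>y\<in>coord_space S. H y = v"
  shows "\<not> has_simple_direct_summand (taft_algebra n q) V"
proof
  assume "has_simple_direct_summand (taft_algebra n q) V"
  then obtain W U where W: "submodule W (taft_algebra n q) V"
    and U: "submodule U (taft_algebra n q) V"
    and WU: "W \<inter> U = {0}" "W <+>\<^bsub>V\<^esub> U = coord_space S" "W \<noteq> {0}"
    and minimal: "\<And>N. submodule N (taft_algebra n q) V \<Longrightarrow> N \<subseteq> W \<Longrightarrow> N = {0} \<or> N = W"
    unfolding left_module.has_simple_direct_summand_iff[OF left_module_operator_module] by auto
  note W = W[unfolded submodule_iff_stable_subspace] and U = U[unfolded submodule_iff_stable_subspace]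
  obtain w where w: "w \<in> W" "w \<noteq> 0"
    using WU(1,3) by blast
  obtain v where v: "v \<in> W" "v \<noteq> 0" "H v = 0"
    using kernel_vector_in_stable_set[of W w] W w by blast
  define N where "N = {x \<in> W. H x = 0}"
  have "submodule N (taft_algebra n q) V"
    unfolding submodule_iff_stable_subspace
  proof (intro conjI ballI)
    show "pm.subspace N"
      using W by (auto simp: N_def pm.subspace_def pm_pair.linear_add[OF linear_H]
          pm_pair.linear_scale[OF linear_H] pm_pair.linear_0[OF linear_H])
  qed (use W pm_pair.linear_0[OF linear_G] pm_pair.linear_0[OF linear_H] in \<open>auto simp: N_def skew\<close>)
  then have "N = W"
    using minimal[of N] v by (auto simp: N_def)
  then have W_kernel: "H x = 0" if "x \<in> W" for x
    using that by (auto simp: N_def)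
  obtain y where y: "y \<in> coord_space S" "H y = v"
    using exact v W by blast
  then obtain w' u where y_split: "y = w' + u" and w': "w' \<in> W" and u: "u \<in> U"
    using y(1) unfolding WU(2)[symmetric] sum_operator_module by auto
  have "v = H u"
    using y(2) W_kernel[OF w'] by (simp add: y_split pm_pair.linear_add[OF linear_H])
  then have "v \<in> W \<inter> U"
    using U u v(1) by simp
  with WU(1) v(2) show False by simp
qed

text \<open>The line through \<open>w\<close> and the kernel of \<open>\<phi>\<close> are
  complementary submodules: the latter is stable under \<open>H\<close> because it contains the
  whole image of \<open>H\<close>, and under \<open>G\<close> because \<open>\<phi>\<close> is an
  eigenvector of the transpose of \<open>G\<close>.\<close>

lemma has_simple_direct_summandI:
  assumes w: "w \<in> coord_space S" "H w = 0" "G w = pm_scale \<mu> w"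
    and add: "\<And>x y. \<phi> (x + y) = \<phi> x + \<phi> y" and scale: "\<And>c x. \<phi> (pm_scale c x) = c * \<phi> x"
    and H: "\<And>v. v \<in> coord_space S \<Longrightarrow> \<phi> (H v) = 0"
    and G: "\<And>v. v \<in> coord_space S \<Longrightarrow> \<phi> (G v) = \<mu> * \<phi> v"
    and nonzero: "\<phi> w \<noteq> 0"
  shows "has_simple_direct_summand (taft_algebra n q) V"
proof -
  define W where "W = range (\<lambda>c. pm_scale c w)"
  define U where "U = {v \<in> coord_space S. \<phi> v = 0}"
  note C = pm.subspace_add[OF subspace_coord_space] pm.subspace_scale[OF subspace_coord_space]
    pm.subspace_0[OF subspace_coord_space] pm.subspace_diff[OF subspace_coord_space]
  have phi_0: "\<phi> 0 = 0"
    using scale[of 0 0] by simp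
  have "w \<noteq> 0"
    using nonzero phi_0 by auto
  have memW: "pm_scale c w \<in> W" for c
    unfolding W_def by (rule rangeI)
  have "pm.subspace W"
  proof (rule pm.subspaceI)
    show "0 \<in> W"
      using memW[of 0] by simp
  next
    fix x y
    assume "x \<in> W" "y \<in> W"
    then show "x + y \<in> W"
      using memW by (auto simp: W_def pm.scale_left_distrib[symmetric])
  next
    fix c x
    assume "x \<in> W"
    then show "pm_scale c x \<in> W"
      using memW by (auto simp: W_def)
  qed
  then have subW: "submodule W (taft_algebra n q) V"
    unfolding submodule_iff_stable_subspace
    using memW w C
    by (auto simp: W_def pm_pair.linear_scale[OF linear_H] pm_pair.linear_scale[OF linear_G]
        intro: memW[of 0, simplified])
  have subU: "submodule U (taft_algebra n q) V"
    unfolding submodule_iff_stable_subspace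
    by (auto simp: U_def add scale phi_0 C H G H_stable G_stable intro!: pm.subspaceI)
  have inter: "W \<inter> U = {0}"
    using nonzero w(1) by (auto simp: W_def U_def scale phi_0 C image_iff intro: exI[of _ 0])
  have sum: "W <+>\<^bsub>V\<^esub> U = coord_space S"
  proof
    show "W <+>\<^bsub>V\<^esub> U \<subseteq> coord_space S"
      using w(1) by (auto simp: sum_operator_module W_def U_def intro!: C)
    show "coord_space S \<subseteq> W <+>\<^bsub>V\<^esub> U"
    proof
      fix v :: "'b \<Rightarrow>\<^sub>0 'k"
      assume v: "v \<in> coord_space S"
      define c where "c = \<phi> v / \<phi> w"
      have "\<phi> v = \<phi> (v - pm_scale c w) + c * \<phi> w"
        using add[of "v - pm_scale c w" "pm_scale c w"] by (simp add: scale)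
      then have "v - pm_scale c w \<in> U"
        using v w(1) nonzero by (simp add: U_def C c_def)
      moreover have "v = pm_scale c w + (v - pm_scale c w)"
        by simp
      ultimately show "v \<in> W <+>\<^bsub>V\<^esub> U"
        unfolding sum_operator_module using memW by blast
    qed
  qed
  have "W \<noteq> {0}"
    using memW[of 1] \<open>w \<noteq> 0\<close> by auto
  moreover have "N = {0} \<or> N = W" if N: "submodule N (taft_algebra n q) V" "N \<subseteq> W" for N
  proof (cases "N = {0}")
    case False
    have N_sub: "pm.subspace N"
      using N(1) by (simp add: submodule_iff_stable_subspace)
    then obtain x where "x \<in> N" "x \<noteq> 0"
      using False pm.subspace_0 by blast
    with N(2) obtain c where c: "pm_scale c w \<in> N" "c \<noteq> 0"
      by (auto simp: W_def)
    have "pm_scale d w \<in> N" for d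
      using pm.subspace_scale[OF N_sub c(1), of "d / c"] c(2) by simp
    then show ?thesis
      using N(2) by (auto simp: W_def)
  qed simp
  ultimately show ?thesis
    unfolding left_module.has_simple_direct_summand_iff[OF left_module_operator_module]
    by (intro exI[of _ W] exI[of _ U] conjI allI impI) (simp_all add: subW subU inter sum)
qed

end


section \<open>The modules \<open>M(l, r)\<close> and their tensor products in coordinates\<close>

lemma primitive_root_nonzero: "primitive_root_of_unity n q \<Longrightarrow> 0 < n \<Longrightarrow> q \<noteq> 0"
  by (auto simp: primitive_root_of_unity_def power_0_left)

lemma taft_M_g_single [simp]:
  "taft_M_g q r (Poly_Mapping.single j c) = Poly_Mapping.single j (c * q powi (r - int j + 1))"
  by (simp add: taft_M_g_def)

lemma taft_M_h_single [simp]: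
  "taft_M_h l (Poly_Mapping.single j c) = (if j < l then Poly_Mapping.single (j + 1) c else 0)"
  by (simp add: taft_M_h_def)

lemma linear_taft_M_g: "pm_linear (taft_M_g q r)"
  unfolding taft_M_g_def by (rule pm_linear_lin_ext)

lemma linear_taft_M_h: "pm_linear (taft_M_h l)"
  unfolding taft_M_h_def by (rule pm_linear_lin_ext)

text \<open>On the whole space \<open>taft_M_h l\<close> also moves the basis vector with index 0,
  so its longest chain runs through the $l + 1$ indices $0, \dots, l$. Therefore $l < n$ is needed
  for the \<open>n\<close>-th power to vanish everywhere.\<close>

lemma taft_M_operators:
  fixes q :: "'k::field"
  assumes q: "primitive_root_of_unity n q" and l: "l < n"
  shows "taft_operators n q (taft_M_g q r) (taft_M_h l) {1..l}"
proof (rule taft_operators.intro)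
  show "pm_linear (taft_M_g q r)" "pm_linear (taft_M_h l)"
    by (rule linear_taft_M_g linear_taft_M_h)+
  have q0: "q \<noteq> 0"
    using primitive_root_nonzero[OF q] l by simp
  have G_iter: "(taft_M_g q r ^^ m) (pm_unit j) =
      Poly_Mapping.single j ((q powi (r - int j + 1)) ^ m)" for m j
  proof (induction m)
    case (Suc m)
    then show ?case
      by (simp add: mult.commute)
  qed simp
  have root: "(q powi e) ^ n = 1" for e
  proof -
    have "(q powi e) ^ n = q powi (int n * e)"
      by (subst mult.commute) (rule power_int_power')
    also have "\<dots> = (q ^ n) powi e"
      by (rule power_int_power[symmetric])
    also have "q ^ n = 1"
      using q by (simp add: primitive_root_of_unity_def)
    finally show ?thesis
      by (simp only: power_int_1_left)
  qed
  show "(taft_M_g q r ^^ n) v = v" for v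
    by (rule pm_linear_eqI[OF pm_linear_funpow[OF linear_taft_M_g] pm_linear_id])
      (simp add: G_iter root)
  have H_iter: "(taft_M_h l ^^ Suc m) (pm_unit j :: nat \<Rightarrow>\<^sub>0 'k) =
      (if j + m < l then pm_unit (j + Suc m) else 0)" for m j
    by (induction m) (auto simp: pm_pair.linear_0[OF linear_taft_M_h])
  show "(taft_M_h l ^^ n) v = 0" for v :: "nat \<Rightarrow>\<^sub>0 'k"
    by (rule pm_linear_eqI[OF pm_linear_funpow[OF linear_taft_M_h] pm_pair.linear_zero])
      (use H_iter[of "n - 1"] l in auto)
  show "taft_M_h l (taft_M_g q r v) = pm_scale q (taft_M_g q r (taft_M_h l v))" for v
  proof (rule pm_linear_eqI[OF pm_linear_comp[OF linear_taft_M_h linear_taft_M_g]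
        pm_pair.linear_compose_scale_right[OF pm_linear_comp[OF linear_taft_M_g linear_taft_M_h]]])
    fix j
    have "q powi (r - int j + 1) = q * q powi (r - int (j + 1) + 1)"
    proof -
      have "r - int (j + 1) + 1 = r - int j" by simp
      then show ?thesis
        by (simp only: power_int_add_1'[OF disjI1[OF q0]])
    qed
    then show "taft_M_h l (taft_M_g q r (pm_unit j)) =
        pm_scale q (taft_M_g q r (taft_M_h l (pm_unit j)))"
      by (simp add: pm_pair.linear_0[OF linear_taft_M_g])
  qed
  fix v :: "nat \<Rightarrow>\<^sub>0 'k"
  assume v: "v \<in> coord_space {1..l}"
  show "taft_M_g q r v \<in> coord_space {1..l}"
    by (rule pm_linear_preserves_coord_space[OF linear_taft_M_g _ v]) (simp add: coord_space_def)
  show "taft_M_h l v \<in> coord_space {1..l}"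
    by (rule pm_linear_preserves_coord_space[OF linear_taft_M_h _ v]) (simp add: coord_space_def)
qed

text \<open>The field is the free vector space on one point, which turns a linear form into a
  linear map between free vector spaces.\<close>

lemma linear_functional_eqI:
  fixes f g :: "('b \<Rightarrow>\<^sub>0 'k::field) \<Rightarrow> 'k"
  assumes "\<And>x y. f (x + y) = f x + f y" "\<And>c x. f (pm_scale c x) = c * f x"
    and "\<And>x y. g (x + y) = g x + g y" "\<And>c x. g (pm_scale c x) = c * g x"
    and "\<And>b. f (pm_unit b) = g (pm_unit b)"
  shows "f v = g v"
proof -
  have "Poly_Mapping.single () (f v) = Poly_Mapping.single () (g v)"
    by (rule pm_linear_eqI[of "\<lambda>v. Poly_Mapping.single () (f v)"]; (rule pm_linearI)?)
      (simp_all add: assms single_add)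
  then show ?thesis
    by (metis lookup_single_eq)
qed

lemma lookup_tensor_g:
  "Poly_Mapping.lookup (tensor_map (taft_M_g q r) (taft_M_g q r') z) (i, j) =
    q powi (r - int i + 1) * q powi (r' - int j + 1) * Poly_Mapping.lookup z (i, j)"
proof (rule linear_functional_eqI[where
      f = "\<lambda>z. Poly_Mapping.lookup (tensor_map (taft_M_g q r) (taft_M_g q r') z) (i, j)"])
  fix p :: "nat \<times> nat"
  obtain a b where p: "p = (a, b)" by fastforce
  show "Poly_Mapping.lookup (tensor_map (taft_M_g q r) (taft_M_g q r') (pm_unit p)) (i, j) =
      q powi (r - int i + 1) * q powi (r' - int j + 1) * Poly_Mapping.lookup (pm_unit p) (i, j)"
    by (simp add: p lookup_single when_def)
qed (simp_all add: pm_pair.linear_add[OF linear_tensor_map] pm_pair.linear_scale[OF linear_tensor_map]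
    lookup_add algebra_simps)

lemma tensor_h_unit:
  "tensor_h (taft_M_h l) (taft_M_g q r') (taft_M_h l') (pm_unit (a, b)) =
    (if b < l' then pm_unit (a, b + 1) else 0) +
    (if a < l then Poly_Mapping.single (a + 1, b) (q powi (r' - int b + 1)) else 0)"
  by (simp add: tensor_h_def)

lemma lookup_tensor_h:
  fixes q :: "'k::field"
  shows "Poly_Mapping.lookup (tensor_h (taft_M_h l) (taft_M_g q r') (taft_M_h l') z) (i, j) =
    (if 1 \<le> j \<and> j \<le> l' then Poly_Mapping.lookup z (i, j - 1) else 0) +
    (if 1 \<le> i \<and> i \<le> l then q powi (r' - int j + 1) * Poly_Mapping.lookup z (i - 1, j) else 0)"
proof (rule linear_functional_eqI[where
      f = "\<lambda>z. Poly_Mapping.lookup (tensor_h (taft_M_h l) (taft_M_g q r') (taft_M_h l') z) (i, j)"])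
  fix p :: "nat \<times> nat"
  obtain a b where p: "p = (a, b)" by fastforce
  have "Poly_Mapping.lookup (if b < l' then pm_unit (a, b + 1) else (0 :: _ \<Rightarrow>\<^sub>0 'k)) (i, j) =
      (if 1 \<le> j \<and> j \<le> l' then Poly_Mapping.lookup (pm_unit (a, b)) (i, j - 1) else 0)"
    by (auto simp: lookup_single when_def)
  moreover have "Poly_Mapping.lookup
      (if a < l then Poly_Mapping.single (a + 1, b) (q powi (r' - int b + 1)) else 0) (i, j) =
      (if 1 \<le> i \<and> i \<le> l then q powi (r' - int j + 1) * Poly_Mapping.lookup (pm_unit (a, b)) (i - 1, j)
        else 0)"
    by (auto simp: lookup_single when_def)
  ultimately show "Poly_Mapping.lookup
      (tensor_h (taft_M_h l) (taft_M_g q r') (taft_M_h l') (pm_unit p)) (i, j) =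
      (if 1 \<le> j \<and> j \<le> l' then Poly_Mapping.lookup (pm_unit p) (i, j - 1) else 0) +
      (if 1 \<le> i \<and> i \<le> l then q powi (r' - int j + 1) * Poly_Mapping.lookup (pm_unit p) (i - 1, j)
        else 0)"
    by (simp only: p tensor_h_unit lookup_add)
qed (simp_all add: tensor_h_def pm_pair.linear_add[OF linear_tensor_map]
    pm_pair.linear_scale[OF linear_tensor_map] lookup_add algebra_simps)


section \<open>Exactness for different lengths\<close>

text \<open>The operator $(a\,f(i,j-1) + b\,f(i-1,j))_{i,j}$ on functions on a grid respects
  antidiagonals. A function in its kernel vanishes where $i + j \leq l'$, by induction on
  \<open>i\<close> from the border $i = 0$. The equation for a preimage \<open>y\<close>
  determines $y(i,j-1)$ from $y(i-1,j)$ for $j > 1$, and the same induction shows that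
  \<open>y\<close> vanishes where $i + j < l'$. What is left are the equations with $j = 1$, which
  only involve $f(i,1)$ and $y(i-1,1)$; both are zero since $i \leq l < l'$.\<close>

lemma grid_kernel_in_image:
  fixes a b f :: "nat \<Rightarrow> nat \<Rightarrow> 'k::field"
  assumes less: "l < l'"
    and supp: "\<And>i j. \<not> (i \<in> {1..l} \<and> j \<in> {1..l'}) \<Longrightarrow> f i j = 0"
    and a: "\<And>i j. a i j \<noteq> 0"
    and kernel: "\<And>i j. i \<in> {1..l} \<Longrightarrow> j \<in> {1..l'} \<Longrightarrow> a i j * f i (j - 1) + b i j * f (i - 1) j = 0"
  obtains y where "\<And>i j. \<not> (i \<in> {1..l} \<and> j \<in> {1..l'}) \<Longrightarrow> y i j = 0"
    and "\<And>i j. i \<in> {1..l} \<Longrightarrow> j \<in> {1..l'} \<Longrightarrow> a i j * y i (j - 1) + b i j * y (i - 1) j = f i j"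
proof -
  have f_vanish: "f i j = 0" if "i + j \<le> l'" for i j
    using that
  proof (induction i arbitrary: j)
    case 0
    then show ?case by (simp add: supp)
  next
    case (Suc i)
    show ?case
    proof (cases "Suc i \<le> l \<and> 1 \<le> j")
      case True
      then show ?thesis
        using kernel[of "Suc i" "Suc j"] Suc.IH[of "Suc j"] Suc.prems a by simp
    qed (auto intro: supp)
  qed
  define y where "y = rec_nat (\<lambda>j. 0) (\<lambda>i y_i j.
    if Suc i \<le> l \<and> 1 \<le> j \<and> j < l'
    then (f (Suc i) (Suc j) - b (Suc i) (Suc j) * y_i (Suc j)) / a (Suc i) (Suc j) else 0)"
  have y_0: "y 0 j = 0" for j
    by (simp add: y_def)
  have y_Suc: "y (Suc i) j = (if Suc i \<le> l \<and> 1 \<le> j \<and> j < l'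
      then (f (Suc i) (Suc j) - b (Suc i) (Suc j) * y i (Suc j)) / a (Suc i) (Suc j) else 0)" for i j
    by (simp add: y_def)
  have y_vanish: "y i j = 0" if "i + j < l'" for i j
    using that by (induction i arbitrary: j) (auto simp: y_0 y_Suc f_vanish)
  show thesis
  proof
    fix i j
    show "y i j = 0" if "\<not> (i \<in> {1..l} \<and> j \<in> {1..l'})"
      using that by (cases i) (auto simp: y_0 y_Suc)
    assume "i \<in> {1..l}" "j \<in> {1..l'}"
    then obtain i' j' where ij: "i = Suc i'" "j = Suc j'" "Suc i' \<le> l" "Suc j' \<le> l'"
      by (cases i; cases j) auto
    show "a i j * y i (j - 1) + b i j * y (i - 1) j = f i j"
    proof (cases "j' = 0")
      case True
      then show ?thesis
        using ij less y_vanish[of i' 1] f_vanish[of i 1] by (simp add: y_Suc)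
    next
      case False
      then show ?thesis
        using ij a by (simp add: y_Suc)
    qed
  qed
qed

lemma poly_mapping_of_grid_function:
  fixes l l' :: nat
  assumes "\<And>i j. \<not> (i \<in> {1..l} \<and> j \<in> {1..l'}) \<Longrightarrow> y i j = (0 :: 'k::field)"
  obtains z where "z \<in> coord_space ({1..l} \<times> {1..l'})"
    and "\<And>i j. Poly_Mapping.lookup z (i, j) = y i j"
proof -
  have support: "{p. (case p of (i, j) \<Rightarrow> y i j) \<noteq> 0} \<subseteq> {1..l} \<times> {1..l'}"
  proof
    fix p
    assume "p \<in> {p. (case p of (i, j) \<Rightarrow> y i j) \<noteq> 0}"
    then show "p \<in> {1..l} \<times> {1..l'}"
      using assms[of "fst p" "snd p"] by (cases p) auto
  qed
  define z where "z = Abs_poly_mapping (\<lambda>(i, j). y i j)"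
  have lookup: "Poly_Mapping.lookup z = (\<lambda>(i, j). y i j)"
    unfolding z_def using finite_subset[OF support] by (simp add: Abs_poly_mapping_inverse)
  show thesis
  proof (rule that[of z])
    have "Poly_Mapping.keys z = {p. (case p of (i, j) \<Rightarrow> y i j) \<noteq> 0}"
      by (auto simp: in_keys_iff lookup)
    then show "z \<in> coord_space ({1..l} \<times> {1..l'})"
      unfolding coord_space_def using support by simp
  qed (simp add: lookup)
qed

text \<open>For $l > l'$ the two coordinates exchange their roles.\<close>

lemma tensor_h_exact:
  assumes "l \<noteq> l'" and q: "q \<noteq> (0 :: 'k::field)"
    and z: "z \<in> coord_space ({1..l} \<times> {1..l'})"
    and kernel: "tensor_h (taft_M_h l) (taft_M_g q r') (taft_M_h l') z = 0"
  shows "\<exists>y\<in>coord_space ({1..l} \<times> {1..l'}). tensor_h (taft_M_h l) (taft_M_g q r') (taft_M_h l') y = z"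
proof -
  have outside: "Poly_Mapping.lookup z (i, j) = 0" if "\<not> (i \<in> {1..l} \<and> j \<in> {1..l'})" for i j
    using lookup_zero_outside_coord_space[OF z] that by simp
  have kernel_at: "Poly_Mapping.lookup z (i, j - 1) +
      q powi (r' - int j + 1) * Poly_Mapping.lookup z (i - 1, j) = 0"
    if "i \<in> {1..l}" "j \<in> {1..l'}" for i j
    using lookup_tensor_h[of l q r' l' z i j] that by (simp add: kernel)
  obtain y where y_supp: "\<And>i j. \<not> (i \<in> {1..l} \<and> j \<in> {1..l'}) \<Longrightarrow> y i j = (0 :: 'k)"
    and y: "\<And>i j. i \<in> {1..l} \<Longrightarrow> j \<in> {1..l'} \<Longrightarrow>
      y i (j - 1) + q powi (r' - int j + 1) * y (i - 1) j = Poly_Mapping.lookup z (i, j)"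
  proof (cases "l < l'")
    case True
    then show thesis
    proof (rule grid_kernel_in_image[of l l' "\<lambda>i j. Poly_Mapping.lookup z (i, j)" "\<lambda>_ _. 1"
          "\<lambda>i j. q powi (r' - int j + 1)"])
      fix y
      assume "\<And>i j. \<not> (i \<in> {1..l} \<and> j \<in> {1..l'}) \<Longrightarrow> y i j = (0 :: 'k)"
        and "\<And>i j. i \<in> {1..l} \<Longrightarrow> j \<in> {1..l'} \<Longrightarrow>
          1 * y i (j - 1) + q powi (r' - int j + 1) * y (i - 1) j = Poly_Mapping.lookup z (i, j)"
      then show thesis
        using that[of y] by simp
    next
      fix i j
      assume "i \<in> {1..l}" "j \<in> {1..l'}"
      then show "1 * Poly_Mapping.lookup z (i, j - 1) +
          q powi (r' - int j + 1) * Poly_Mapping.lookup z (i - 1, j) = 0"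
        using kernel_at by (simp only: mult_1_left)
    qed (simp_all only: outside one_neq_zero not_False_eq_True)
  next
    case False
    with assms(1) have "l' < l" by simp
    then show thesis
    proof (rule grid_kernel_in_image[of l' l "\<lambda>j i. Poly_Mapping.lookup z (i, j)"
            "\<lambda>j i. q powi (r' - int j + 1)" "\<lambda>_ _. 1"])
      fix y
      assume supp: "\<And>j i. \<not> (j \<in> {1..l'} \<and> i \<in> {1..l}) \<Longrightarrow> y j i = (0 :: 'k)"
        and eq: "\<And>j i. j \<in> {1..l'} \<Longrightarrow> i \<in> {1..l} \<Longrightarrow>
          q powi (r' - int j + 1) * y j (i - 1) + 1 * y (j - 1) i = Poly_Mapping.lookup z (i, j)"
      show thesis
      proof (rule that[of "\<lambda>i j. y j i"])
        fix i j
        show "y j i = 0" if "\<not> (i \<in> {1..l} \<and> j \<in> {1..l'})"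
          using that supp by blast
        show "y (j - 1) i + q powi (r' - int j + 1) * y j (i - 1) = Poly_Mapping.lookup z (i, j)"
          if "i \<in> {1..l}" "j \<in> {1..l'}"
          using eq[OF that(2,1)] by (simp only: mult_1_left add.commute)
      qed
    next
      fix i j
      assume "j \<in> {1..l'}" "i \<in> {1..l}"
      then show "q powi (r' - int j + 1) * Poly_Mapping.lookup z (i - 1, j) +
          1 * Poly_Mapping.lookup z (i, j - 1) = 0"
        using kernel_at[of i j] by (simp only: mult_1_left add.commute)
    next
      fix i j
      show "q powi (r' - int j + 1) \<noteq> 0"
        using q by simp
    qed (use outside in blast)
  qed
  obtain Y where Y: "Y \<in> coord_space ({1..l} \<times> {1..l'})" "\<And>i j. Poly_Mapping.lookup Y (i, j) = y i j"
    using poly_mapping_of_grid_function[of l l' y] y_supp by blast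
  have "tensor_h (taft_M_h l) (taft_M_g q r') (taft_M_h l') Y = z"
  proof (rule poly_mapping_eqI)
    fix p :: "nat \<times> nat"
    obtain i j where p: "p = (i, j)" by fastforce
    have "Poly_Mapping.lookup (tensor_h (taft_M_h l) (taft_M_g q r') (taft_M_h l') Y) (i, j) =
        Poly_Mapping.lookup z (i, j)"
    proof (cases "i \<in> {1..l} \<and> j \<in> {1..l'}")
      case True
      then show ?thesis
        using y[of i j] by (simp add: lookup_tensor_h Y)
    next
      case False
      then show ?thesis
        using outside[of i j] y_supp[of i "j - 1"] y_supp[of "i - 1" j]
        by (auto simp: lookup_tensor_h Y)
    qed
    then show "Poly_Mapping.lookup (tensor_h (taft_M_h l) (taft_M_g q r') (taft_M_h l') Y) p =
        Poly_Mapping.lookup z p" by (simp add: p)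
  qed
  with Y(1) show ?thesis by blast
qed


section \<open>A split eigenvector for equal lengths\<close>

text \<open>The coefficients of the vector $\sum_i c_i\, v_i \otimes v_{l+1-i}$, determined up to
  a common factor by the condition that $h$ kills it: the coefficient of its image at $v_{i+1}
  \otimes v_{l+1-i}$ is $c_{i+1} + q^{r-l+i} c_i$, where \<open>r\<close> belongs to the second
  factor.\<close>

definition antidiagonal_coeff :: "'k::field \<Rightarrow> int \<Rightarrow> nat \<Rightarrow> nat \<Rightarrow> 'k"
  where "antidiagonal_coeff q r l i = (\<Prod>t<i. - (q powi (r - int l + int t)))"

lemma antidiagonal_coeff_Suc:
  "antidiagonal_coeff q r l (Suc i) = - (q powi (r - int l + int i)) * antidiagonal_coeff q r l i"
  by (simp add: antidiagonal_coeff_def)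

lemma antidiagonal_coeff_nonzero: "q \<noteq> 0 \<Longrightarrow> antidiagonal_coeff q r l i \<noteq> 0"
  by (simp add: antidiagonal_coeff_def)

definition antidiagonal_functional ::
    "'k::field \<Rightarrow> int \<Rightarrow> nat \<Rightarrow> (nat \<times> nat \<Rightarrow>\<^sub>0 'k) \<Rightarrow> 'k"
  where "antidiagonal_functional q r l z =
    (\<Sum>i=1..l. inverse q ^ i / antidiagonal_coeff q r l i * Poly_Mapping.lookup z (i, l + 1 - i))"

text \<open>The weights $d_i = q^{-i}/c_i$ satisfy $d_{i+1} q^{r-l+i+1} = -d_i$, so the sum
  telescopes to its boundary terms. These refer to places outside the grid.\<close>

lemma antidiagonal_functional_h:
  assumes q: "q \<noteq> (0 :: 'k::field)" and z: "z \<in> coord_space ({1..l} \<times> {1..l})"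
  shows "antidiagonal_functional q r l (tensor_h (taft_M_h l) (taft_M_g q r) (taft_M_h l) z) = 0"
proof -
  define d where "d i = inverse q ^ i / antidiagonal_coeff q r l i" for i
  define u where "u t = Poly_Mapping.lookup z (t, l - t)" for t
  have d_Suc: "d (Suc t) * q powi (r - int l + int t + 1) = - d t" for t
  proof -
    define p where "p = q powi (r - int l + int t)"
    have "p \<noteq> 0" and step: "q powi (r - int l + int t + 1) = p * q"
      using q by (simp_all add: p_def power_int_add_1)
    then show ?thesis
      unfolding d_def antidiagonal_coeff_Suc p_def[symmetric] step
      using q antidiagonal_coeff_nonzero[OF q, of r l t] by (simp add: divide_simps)
  qed
  have u_boundary: "u 0 = 0" "u l = 0"
    using lookup_zero_outside_coord_space[OF z] by (simp_all add: u_def)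
  have coeff: "d i * Poly_Mapping.lookup
      (tensor_h (taft_M_h l) (taft_M_g q r) (taft_M_h l) z) (i, l + 1 - i) =
      d i * u i - d (i - 1) * u (i - 1)" if "i \<in> {1..l}" for i
  proof -
    define t where "t = i - 1"
    have t: "i = Suc t" "t < l"
      using that by (auto simp: t_def)
    have index: "l + 1 - i = l - t" and exponent: "r - int (l - t) + 1 = r - int l + int t + 1"
      using t by (simp_all add: of_nat_diff)
    have "Poly_Mapping.lookup (tensor_h (taft_M_h l) (taft_M_g q r) (taft_M_h l) z) (i, l + 1 - i) =
        u i + q powi (r - int l + int t + 1) * u t"
    proof -
      have bounds: "1 \<le> l - t" "l - t \<le> l" "l - t - 1 = l - i" "i - 1 = t" "1 \<le> i" "i \<le> l"
        using t by auto
      show ?thesis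
        by (simp only: lookup_tensor_h index exponent bounds u_def simp_thms if_True)
    qed
    then show ?thesis
      using d_Suc[of t] t by (simp only: distrib_left mult.assoc[symmetric]) simp
  qed
  have "antidiagonal_functional q r l (tensor_h (taft_M_h l) (taft_M_g q r) (taft_M_h l) z) =
      (\<Sum>i=1..l. d i * u i - d (i - 1) * u (i - 1))"
    unfolding antidiagonal_functional_def d_def[symmetric]
    by (rule sum.cong) (use coeff in auto)
  also have "\<dots> = (\<Sum>t<l. d (Suc t) * u (Suc t) - d t * u t)"
    by (rule sum.reindex_bij_witness[of _ Suc "\<lambda>i. i - 1"]) auto
  also have "\<dots> = d l * u l - d 0 * u 0"
    by (rule sum_lessThan_telescope)
  finally show ?thesis
    by (simp add: u_boundary)
qed

text \<open>A geometric sum: if it were zero, then $q^{-l} = 1$.\<close>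

lemma sum_inverse_powers_nonzero:
  assumes "primitive_root_of_unity n q" "0 < l" "l < n"
  shows "(\<Sum>i=1..l. inverse q ^ i) \<noteq> (0 :: 'k::field)"
proof
  have q0: "q \<noteq> 0"
    using primitive_root_nonzero[OF assms(1)] assms(3) by simp
  assume "(\<Sum>i=1..l. inverse q ^ i) = 0"
  moreover have "(\<Sum>i=1..l. inverse q ^ i) = inverse q * (\<Sum>i<l. inverse q ^ i)"
    unfolding sum_distrib_left
    by (rule sum.reindex_bij_witness[of _ Suc "\<lambda>i. i - 1"]) (auto simp: power_eq_if)
  ultimately have "inverse q ^ l = 1"
    using power_diff_1_eq[of "inverse q" l] q0 by simp
  then have "q ^ l = 1"
    by (simp add: power_inverse)
  with assms show False
    by (auto simp: primitive_root_of_unity_def)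
qed

lemma antidiagonal_vector:
  assumes q: "q \<noteq> (0 :: 'k::field)"
  obtains w where "w \<in> coord_space ({1..l} \<times> {1..l})"
    and "tensor_h (taft_M_h l) (taft_M_g q r') (taft_M_h l) w = 0"
    and "tensor_map (taft_M_g q r) (taft_M_g q r') w = pm_scale (q powi (r + r' + 1 - int l)) w"
    and "antidiagonal_functional q r' l w = (\<Sum>i=1..l. inverse q ^ i)"
proof -
  define c where "c = antidiagonal_coeff q r' l"
  obtain w where w: "w \<in> coord_space ({1..l} \<times> {1..l})"
    and lookup: "\<And>i j. Poly_Mapping.lookup w (i, j) = (if i \<in> {1..l} \<and> i + j = l + 1 then c i else 0)"
    by (rule poly_mapping_of_grid_function[of l l
          "\<lambda>i j. if i \<in> {1..l} \<and> i + j = l + 1 then c i else 0"]) auto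
  have "Poly_Mapping.lookup (tensor_h (taft_M_h l) (taft_M_g q r') (taft_M_h l) w) (i, j) = 0" for i j
  proof (cases "i + j = l + 2 \<and> 2 \<le> i \<and> i \<le> l")
    case True
    then obtain t where t: "i = Suc t" "j = l + 1 - t" "1 \<le> t" "Suc t \<le> l"
      by (cases i) auto
    then have "r' - int j + 1 = r' - int l + int t" and "1 \<le> j" "j \<le> l"
      by (simp_all add: of_nat_diff)
    then have "Poly_Mapping.lookup (tensor_h (taft_M_h l) (taft_M_g q r') (taft_M_h l) w) (i, j) =
        c (Suc t) + q powi (r' - int l + int t) * c t"
      using t by (simp only: lookup_tensor_h lookup) simp
    then show ?thesis
      by (simp only: c_def antidiagonal_coeff_Suc) simp
  next
    case False
    then show ?thesis
      by (auto simp: lookup_tensor_h lookup)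
  qed
  then have "tensor_h (taft_M_h l) (taft_M_g q r') (taft_M_h l) w = 0"
    by (intro poly_mapping_eqI) (metis lookup_zero surj_pair)
  moreover have "tensor_map (taft_M_g q r) (taft_M_g q r') w = pm_scale (q powi (r + r' + 1 - int l)) w"
  proof (rule poly_mapping_eqI)
    fix p :: "nat \<times> nat"
    obtain i j where p: "p = (i, j)" by fastforce
    have "q powi (r - int i + 1) * q powi (r' - int j + 1) = q powi (r + r' + 1 - int l)"
      if "i + j = l + 1"
    proof -
      have "(r - int i + 1) + (r' - int j + 1) = r + r' + 1 - int l"
        using that by linarith
      then show ?thesis
        by (simp only: power_int_add[OF disjI1[OF q], symmetric])
    qed
    then show "Poly_Mapping.lookup (tensor_map (taft_M_g q r) (taft_M_g q r') w) p =
        Poly_Mapping.lookup (pm_scale (q powi (r + r' + 1 - int l)) w) p"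
      by (simp add: p lookup_tensor_g lookup)
  qed
  moreover have "antidiagonal_functional q r' l w = (\<Sum>i=1..l. inverse q ^ i)"
    unfolding antidiagonal_functional_def
    by (rule sum.cong) (simp_all add: lookup c_def antidiagonal_coeff_nonzero[OF q])
  ultimately show thesis
    using that w by blast
qed

lemma antidiagonal_functional_g:
  assumes q: "q \<noteq> (0 :: 'k::field)"
  shows "antidiagonal_functional q r' l (tensor_map (taft_M_g q r) (taft_M_g q r') z) =
    q powi (r + r' + 1 - int l) * antidiagonal_functional q r' l z"
proof -
  have "q powi (r - int i + 1) * q powi (r' - int (l + 1 - i) + 1) = q powi (r + r' + 1 - int l)"
    if "i \<in> {1..l}" for i
  proof -
    have "(r - int i + 1) + (r' - int (l + 1 - i) + 1) = r + r' + 1 - int l"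
      using that by (simp add: of_nat_diff)
    then show ?thesis
      by (simp only: power_int_add[OF disjI1[OF q], symmetric])
  qed
  then show ?thesis
    unfolding antidiagonal_functional_def sum_distrib_left
    by (intro sum.cong) (simp_all add: lookup_tensor_g)
qed

theorem corollary3p5:
  fixes n l l' :: nat and r r' :: int and q :: "'k::field"
  assumes "n \<ge> 2"
    and "primitive_root_of_unity n q"
    and "1 \<le> l" and "l \<le> n - 1"
    and "1 \<le> l'" and "l' \<le> n - 1"
  shows "has_simple_direct_summand (taft_algebra n q)
           (taft_tensor n q (taft_M n q l r) (taft_M n q l' r')) \<longleftrightarrow> l = l'"
proof -
  have less: "l < n" "l' < n" and q: "q \<noteq> 0"
    using assms primitive_root_nonzero[of n q] by auto
  interpret taft_operators_pair n q "taft_M_g q r" "taft_M_h l" "{1..l}"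
    "taft_M_g q r'" "taft_M_h l'" "{1..l'}"
    by (intro taft_operators_pair.intro taft_operators_pair_axioms.intro taft_M_operators
        assms less)
  have "has_simple_direct_summand (taft_algebra n q) T.V \<longleftrightarrow> l = l'"
  proof
    assume "has_simple_direct_summand (taft_algebra n q) T.V"
    then show "l = l'"
      using T.no_simple_direct_summand tensor_h_exact[of l l' q _ r'] q by blast
  next
    assume l: "l = l'"
    obtain w where "w \<in> coord_space ({1..l} \<times> {1..l})"
      "tensor_h (taft_M_h l) (taft_M_g q r') (taft_M_h l) w = 0"
      "tensor_map (taft_M_g q r) (taft_M_g q r') w = pm_scale (q powi (r + r' + 1 - int l)) w"
      "antidiagonal_functional q r' l w = (\<Sum>i=1..l. inverse q ^ i)"
      using antidiagonal_vector[OF q] by blast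
    moreover have "(\<Sum>i=1..l. inverse q ^ i) \<noteq> 0"
      using sum_inverse_powers_nonzero[OF assms(2), of l] assms(3) less by simp
    ultimately show "has_simple_direct_summand (taft_algebra n q) T.V"
      using l q
      by (intro T.has_simple_direct_summandI[where w = w and \<phi> = "antidiagonal_functional q r' l"
            and \<mu> = "q powi (r + r' + 1 - int l)"])
        (simp_all add: antidiagonal_functional_h antidiagonal_functional_g,
         simp_all add: antidiagonal_functional_def lookup_add sum.distrib sum_distrib_left
          algebra_simps)
  qed
  then show ?thesis
    using left_module_iso.has_simple_direct_summand_iso[OF taft_tensor_iso]
    by (simp add: taft_M_eq_operator_module)
qed

end
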